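(* Let $G$ be an infinite countable discrete amenable group, let $(X,\mathcal{B}_X^\mu,\mu,G)$ be an ergodic $G$-measure preserving dynamical system, let $(G_n)_{n\ge 1}$ be a sequence of non-empty finite subsets of $G$, and let $\mathcal{P}_\mu(G)$ be the Pinsker $\sigma$-algebra of $(X,\mathcal{B}_X^\mu,\mu,G)$. If $\lim_{n\to\infty}|G_n|=\infty$, then $\mathcal{P}_\mu(G)$ is a characteristic factor for $(G_n)_{n\ge 1}$.
   Context: A $G$-topological dynamical system ($G$-tds) $(X,G)$ is a compact metric space $X$ on which $G$ acts continuously. $\mathcal{B}_X$ is the Borel $\sigma$-algebra of $X$. A $G$-measure preserving dynamical system ($G$-mps) $(X,\mathcal{B}_X^\mu,\mu,G)$ consists of a $G$-tds $(X,G)$, a $G$-invariant Borel probability measure $\mu$ on $X$, and the completion $\mathcal{B}_X^\mu$ of $\mathcal{B}_X$ under $\mu$. It is ergodic if $\mu(\bigcup_{g\in G}gA)\in\{0,1\}$ for every $A\in\mathcal{B}_X$. $L^2(X,\mathcal{B}_X^\mu,\mu)$ is the space of real-valued measurable functions $f$ with $\|f\|_2=(\int f^2\,d\mu)^{1/2}<\infty$. For $f:X\to\mathbb{R}$ and a non-empty finite $F\subset G$, $\mathbf{A}(F,f)(x)=\frac{1}{|F|}\sum_{g\in F}f(gx)$. A sub-$\sigma$-algebra $\mathcal{F}$ of $\mathcal{B}_X^\mu$ is called a characteristic factor for $(G_n)_{n\ge1}$ if for every $f\in L^2(X,\mathcal{B}_X^\mu,\mu)$, $\lim_{n\to\infty}\|\mathbf{A}(G_n,f)-\mathbf{A}(G_n,\mathbb{E}(f|\mathcal{F}))\|_2=0$,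 where $\mathbb{E}(f|\mathcal{F})$ is the conditional expectation. A Følner sequence is a sequence $(F_n)$ of non-empty finite subsets of $G$ with $|gF_n\Delta F_n|/|F_n|\to0$ for every $g\in G$. For a finite measurable partition $\alpha$, $H_\mu(\alpha)=-\sum_{A\in\alpha}\mu(A)\log\mu(A)$ and $h_\mu(G,\alpha)=\lim_{n\to\infty}\frac{1}{|F_n|}H_\mu(\bigvee_{g\in F_n}g^{-1}\alpha)$, where $(F_n)$ is any Følner sequence (the limit exists and is independent of it). The Pinsker $\sigma$-algebra is $\mathcal{P}_\mu(G)=\{A\in\mathcal{B}_X^\mu: h_\mu(G,\{A,A^c\})=0\}$. *)

theory Defs
  imports "HOL-Probability.Probability" "HOL-Algebra.Group_Action"
begin

definition folner_sequence :: "('g, 'b) monoid_scheme \<Rightarrow> (nat \<Rightarrow> 'g set) \<Rightarrow> bool" where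
  "folner_sequence G F \<longleftrightarrow>
     (\<forall>n. F n \<subseteq> carrier G \<and> finite (F n) \<and> F n \<noteq> {}) \<and>
     (\<forall>g\<in>carrier G.
        (\<lambda>n. real (card (((g <#\<^bsub>G\<^esub> F n) - F n) \<union> (F n - (g <#\<^bsub>G\<^esub> F n)))) / real (card (F n)))
          \<longlonglongrightarrow> 0)"

text \<open>Amenability of countable discrete groups; for uncountable groups Folner nets would be
  needed instead of sequences.\<close>

definition amenable :: "('g, 'b) monoid_scheme \<Rightarrow> bool" where
  "amenable G \<longleftrightarrow> (\<exists>F. folner_sequence G F)"

text \<open>As \<open>G\<close> carries the discrete topology, joint continuity of the action amounts to
  continuity of each map \<open>\<phi> g\<close>.\<close>

locale G_tds = group_action G "UNIV :: ('x :: metric_space) set" \<phi>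
  for G :: "('g, 'b) monoid_scheme" (structure) and \<phi> :: "'g \<Rightarrow> ('x :: metric_space) \<Rightarrow> 'x" +
  assumes compact_space: "compact (UNIV :: ('x :: metric_space) set)"
    and continuous_action: "g \<in> carrier G \<Longrightarrow> continuous_on UNIV (\<phi> g)"

text \<open>Here \<open>\<mu>\<close> is the measure on the Borel sets; the completed system is given by
  \<open>completion \<mu>\<close>.\<close>

locale G_mps = G_tds G \<phi> + prob_space \<mu>
  for G :: "('g, 'b) monoid_scheme" (structure)
    and \<phi> :: "'g \<Rightarrow> ('x :: metric_space) \<Rightarrow> 'x" and \<mu> :: "('x :: metric_space) measure" +
  assumes sets_borel: "sets \<mu> = sets borel"
    and invariant: "g \<in> carrier G \<Longrightarrow> A \<in> sets borel \<Longrightarrow> measure \<mu> (\<phi> g -` A) = measure \<mu> A"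

locale ergodic_G_mps = G_mps G \<phi> \<mu>
  for G :: "('g, 'b) monoid_scheme" (structure)
    and \<phi> :: "'g \<Rightarrow> ('x :: metric_space) \<Rightarrow> 'x" and \<mu> :: "('x :: metric_space) measure" +
  assumes ergodic: "A \<in> sets borel \<Longrightarrow> measure \<mu> (\<Union>g\<in>carrier G. \<phi> g ` A) \<in> {0, 1}"

definition ergodic_average :: "('g \<Rightarrow> 'x \<Rightarrow> 'x) \<Rightarrow> 'g set \<Rightarrow> ('x \<Rightarrow> real) \<Rightarrow> 'x \<Rightarrow> real" where
  "ergodic_average \<phi> F f x = (\<Sum>g\<in>F. f (\<phi> g x)) / real (card F)"

definition L2 :: "'x measure \<Rightarrow> ('x \<Rightarrow> real) set" where
  "L2 M = {f \<in> borel_measurable M. integrable M (\<lambda>x. (f x)\<^sup>2)}"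

definition L2_norm :: "'x measure \<Rightarrow> ('x \<Rightarrow> real) \<Rightarrow> real" where
  "L2_norm M f = sqrt (\<integral>x. (f x)\<^sup>2 \<partial>M)"

text \<open>Below \<open>M\<close> is the completed measure. \<open>sigma (space M) \<F>\<close> merely packages the
  \<open>\<sigma>\<close>-algebra \<open>\<F>\<close> as a measure, as \<^const>\<open>real_cond_exp\<close> expects; since
  \<open>\<F>\<close> is required to be a \<open>\<sigma>\<close>-algebra, its sets are exactly \<open>\<F>\<close>.\<close>

definition characteristic_factor ::
  "'x measure \<Rightarrow> ('g \<Rightarrow> 'x \<Rightarrow> 'x) \<Rightarrow> (nat \<Rightarrow> 'g set) \<Rightarrow> 'x set set \<Rightarrow> bool" where
  "characteristic_factor M \<phi> S \<F> \<longleftrightarrow>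
     sigma_algebra (space M) \<F> \<and> \<F> \<subseteq> sets M \<and>
     (\<forall>f\<in>L2 M.
        (\<lambda>n. L2_norm M (\<lambda>x. ergodic_average \<phi> (S n) f x
               - ergodic_average \<phi> (S n) (real_cond_exp M (sigma (space M) \<F>) f) x))
          \<longlonglongrightarrow> 0)"

definition partition_entropy :: "'x measure \<Rightarrow> 'x set set \<Rightarrow> real" where
  "partition_entropy M \<alpha> = - (\<Sum>A\<in>\<alpha>. measure M A * ln (measure M A))"

text \<open>Cells of a join may be empty; they do not contribute to the entropy, as
  \<open>0 * ln 0 = 0\<close>.\<close>

definition partition_join :: "'i set \<Rightarrow> ('i \<Rightarrow> 'x set set) \<Rightarrow> 'x set set" where
  "partition_join I \<alpha> = {(\<Inter>i\<in>I. a i) |a. a \<in> (\<Pi>\<^sub>E i\<in>I. \<alpha> i)}"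

definition dynamical_entropy ::
  "('g, 'b) monoid_scheme \<Rightarrow> ('g \<Rightarrow> 'x \<Rightarrow> 'x) \<Rightarrow> 'x measure \<Rightarrow> 'x set set \<Rightarrow> real" where
  "dynamical_entropy G \<phi> M \<alpha> =
     (THE h. \<forall>F. folner_sequence G F \<longrightarrow>
        (\<lambda>n. partition_entropy M (partition_join (F n) (\<lambda>g. (\<lambda>A. \<phi> g -` A) ` \<alpha>)) / real (card (F n)))
          \<longlonglongrightarrow> h)"

definition pinsker_algebra ::
  "('g, 'b) monoid_scheme \<Rightarrow> ('g \<Rightarrow> 'x \<Rightarrow> 'x) \<Rightarrow> 'x measure \<Rightarrow> 'x set set" where
  "pinsker_algebra G \<phi> M = {A \<in> sets M. dynamical_entropy G \<phi> M {A, space M - A} = 0}"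

end

theory Submission
  imports Defs "HOL-Library.Diagonal_Subsequence"
begin

text \<open>
  Write \<open>P\<close> for the Pinsker algebra, \<open>E(f | P)\<close> for the conditional expectation and
  \<open>v = f - E(f | P)\<close>. The difference of the two averages in the theorem is the average of \<open>v\<close>
  over \<open>S n\<close>, and its squared norm is the mean of the correlations
  \<open>\<rho> (g \<otimes> inv h) = (\<integral>x. v (\<phi> (g \<otimes> inv h) x) * v x)\<close> over all pairs \<open>g, h\<close> in \<open>S n\<close>. If
  \<open>\<rho> k\<close> tends to \<open>0\<close> as \<open>k\<close> leaves every finite subset of the group, then for each \<open>g\<close> only a
  bounded number of \<open>h\<close> contribute a correlation that is not small, and the mean tends to \<open>0\<close>
  with \<open>card (S n) \<rightarrow> \<infinity>\<close> (\<open>averages_vanish_if_mixing\<close>). So the matter is decay of correlations,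
  and by approximation it suffices to correlate the translates of a single event \<open>A\<close> with \<open>v\<close>.

  Suppose that infinitely many translates \<open>\<phi> k -` A\<close> correlate with \<open>v\<close> by at least \<open>c > 0\<close>
  (\<open>finite_large_correlation\<close>). A subsequence \<open>\<gamma> i\<close> of these \<open>k\<close> has asymptotically constant
  pairwise correlations \<open>prob (\<phi> (\<gamma> i) -` A \<inter> \<phi> (\<gamma> j) -` A)\<close>. Then the frequencies of occurrence
  in \<open>\<phi> (\<gamma> i) -` A\<close>, taken over any large set of large indices \<open>i\<close>, are all close in norm to one and
  the same function \<open>u\<close> (\<open>frequency_L2_limit\<close>), and \<open>u\<close> still correlates with \<open>v\<close>. As \<open>v\<close> is
  orthogonal to all square-integrable \<open>P\<close>-measurable functions, a contradiction follows once \<open>u\<close> is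
  \<open>P\<close>-measurable.

  This is the heart of the proof (\<open>entropy_rate_eq_0_if_determined_far_away\<close>). A level set \<open>C\<close> of
  \<open>u\<close> is determined, up to a small error, by \<^emph>\<open>any\<close> \<open>n\<close> of the events \<open>\<phi> (\<gamma> i) -` A\<close> with large
  \<open>i\<close>; this freedom makes \<open>C\<close> visible from a sparse set of translates of \<open>A\<close>. Given a large
  Folner set \<open>F\<close>, a set \<open>R\<close> with \<open>card R \<le> \<epsilon> * card F\<close> can be found that contains \<open>n\<close> suitable
  elements \<open>\<gamma> i \<otimes> g\<close> for all but \<open>\<epsilon> * card F\<close> of the \<open>g\<close> in \<open>F\<close>. The translates of \<open>C\<close> over
  \<open>F\<close> are then almost functions of the translates of \<open>A\<close> over \<open>R\<close>, so their joint entropy is at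
  most a constant times \<open>\<epsilon> * card F\<close>. Hence \<open>C\<close> has entropy zero.

  What is needed about entropy is elementary. The joint entropy of a finite family of events is
  submodular (\<open>family_entropy_insert2\<close>), and Shearer's inequality then bounds the entropy over \<open>F\<close>
  by \<open>card (inv K F) / card K\<close> times the entropy over any finite \<open>K\<close>. For Folner sets the quotient is
  about \<open>card F / card K\<close>, so the entropy per element converges to its infimum over all finite sets
  (\<open>orbit_entropy_tendsto_rate\<close>), and an event lies in \<open>P\<close> iff this infimum is \<open>0\<close>. That \<open>P\<close> is
  an invariant \<open>\<sigma>\<close>-algebra follows from subadditivity and from the continuity of
  entropy in the event.\<close>

section \<open>Entropy of a finite family of events\<close>

definition neg_x_ln_x :: "real \<Rightarrow> real" where
  "neg_x_ln_x t = - (t * ln t)"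

lemma neg_x_ln_x_0 [simp]: "neg_x_ln_x 0 = 0" and neg_x_ln_x_1 [simp]: "neg_x_ln_x 1 = 0"
  by (simp_all add: neg_x_ln_x_def)

lemma neg_x_ln_x_le_one_minus: "neg_x_ln_x t \<le> 1 - t" if "0 \<le> t"
proof (cases "t = 0")
  case False
  with that have "t * ln (1 / t) \<le> t * (1 / t - 1)"
    by (intro mult_left_mono ln_le_minus_one) auto
  with False that show ?thesis
    by (simp add: neg_x_ln_x_def ln_div right_diff_distrib)
qed simp

text \<open>This gives an explicit rate for the continuity of the entropy at null events: apply
  \<open>ln s \<ge> 1 - 1 / s\<close> to \<open>s = sqrt t\<close> instead of \<open>t\<close>.\<close>

lemma neg_x_ln_x_le_sqrt: "neg_x_ln_x t \<le> 2 * sqrt t" if "0 \<le> t"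
proof (cases "t = 0")
  case False
  define s where "s = sqrt t"
  have s: "s > 0" "t = s\<^sup>2" using that False by (simp_all add: s_def)
  have "s * neg_x_ln_x s \<le> s * 1"
    using neg_x_ln_x_le_one_minus[of s] s by (intro mult_left_mono) auto
  moreover have "neg_x_ln_x t = 2 * (s * neg_x_ln_x s)"
    using ln_realpow[of s 2] s by (simp add: neg_x_ln_x_def power2_eq_square)
  ultimately show ?thesis by (simp flip: s_def)
qed simp

lemma neg_x_ln_x_nonneg: "0 \<le> neg_x_ln_x t" if "0 \<le> t" "t \<le> 1"
proof (cases "t = 0")
  case False
  with that have "ln t \<le> 0" by simp
  with that show ?thesis by (simp add: neg_x_ln_x_def mult_nonneg_nonpos)
qed simp

lemma neg_x_ln_x_add_le: "neg_x_ln_x (a + b) \<le> neg_x_ln_x a + neg_x_ln_x b" if "0 \<le> a" "0 \<le> b"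
proof (cases "a = 0 \<or> b = 0")
  case False
  with that have "a * ln a \<le> a * ln (a + b)" "b * ln b \<le> b * ln (a + b)"
    by (auto intro!: mult_left_mono)
  then show ?thesis by (simp add: neg_x_ln_x_def algebra_simps)
qed auto

text \<open>One summand of Gibbs' inequality, from \<open>ln y \<le> y - 1\<close> at \<open>y = p * q / (a * z)\<close>: here \<open>a\<close> is the
  mass of a cell, \<open>p\<close> and \<open>q\<close> are its marginals and \<open>z\<close> is the total mass.\<close>

lemma neg_x_ln_x_gibbs:
  assumes "0 \<le> a" "a \<le> p" "a \<le> q" "0 < z"
  shows "a * ln p + a * ln q + neg_x_ln_x a - a * ln z \<le> p * q / z - a"
proof (cases "a = 0")
  case False
  with assms have pos: "a > 0" "p > 0" "q > 0" by auto
  have "a * ln (p * q / (a * z)) \<le> a * (p * q / (a * z) - 1)"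
    using pos assms by (intro mult_left_mono ln_le_minus_one) auto
  moreover have "ln (p * q / (a * z)) = ln p + ln q - ln a - ln z"
    using pos assms by (simp add: ln_div ln_mult)
  moreover have "a * (p * q / (a * z) - 1) = p * q / z - a"
    using pos by (simp add: right_diff_distrib)
  ultimately show ?thesis by (simp add: neg_x_ln_x_def algebra_simps)
qed (use assms in auto)

text \<open>Submodularity of entropy inside one atom, which two further events cut into four cells of masses
  \<open>a, b, c, d\<close>: summing \<open>neg_x_ln_x_gibbs\<close> over the cells, the products of the marginals add up to
  \<open>(a + b + c + d)\<^sup>2\<close>, so that the right-hand sides cancel.\<close>

lemma neg_x_ln_x_submodular:
  assumes "0 \<le> a" "0 \<le> b" "0 \<le> c" "0 \<le> d"
  shows "neg_x_ln_x a + neg_x_ln_x b + neg_x_ln_x c + neg_x_ln_x d + neg_x_ln_x (a + b + c + d)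
    \<le> (neg_x_ln_x (a + b) + neg_x_ln_x (c + d)) + (neg_x_ln_x (a + c) + neg_x_ln_x (b + d))"
proof (cases "a + b + c + d = 0")
  case True
  with assms have "a = 0" "b = 0" "c = 0" "d = 0" by auto
  then show ?thesis by simp
next
  case False
  define z where "z = a + b + c + d"
  have z: "z > 0" using False assms by (auto simp: z_def)
  have "(a + b) * (a + c) / z + (a + b) * (b + d) / z + (c + d) * (a + c) / z + (c + d) * (b + d) / z
      = (z * z) / z"
    unfolding add_divide_distrib[symmetric] by (simp add: z_def algebra_simps)
  then have "(a + b) * (a + c) / z + (a + b) * (b + d) / z + (c + d) * (a + c) / z + (c + d) * (b + d) / z = z"
    using z by simp
  moreover have "neg_x_ln_x z = - (a * ln z) - b * ln z - c * ln z - d * ln z"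
    by (simp add: neg_x_ln_x_def z_def algebra_simps)
  moreover have "neg_x_ln_x (u + v) = - (u * ln (u + v)) - v * ln (u + v)" for u v
    by (simp add: neg_x_ln_x_def algebra_simps)
  note this[of a b] this[of c d] this[of a c] this[of b d]
  moreover have "a * ln (a + b) + a * ln (a + c) + neg_x_ln_x a - a * ln z \<le> (a + b) * (a + c) / z - a"
    "b * ln (a + b) + b * ln (b + d) + neg_x_ln_x b - b * ln z \<le> (a + b) * (b + d) / z - b"
    "c * ln (c + d) + c * ln (a + c) + neg_x_ln_x c - c * ln z \<le> (c + d) * (a + c) / z - c"
    "d * ln (c + d) + d * ln (b + d) + neg_x_ln_x d - d * ln z \<le> (c + d) * (b + d) / z - d"
    by (rule neg_x_ln_x_gibbs; use assms z in simp)+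
  ultimately show ?thesis
    unfolding z_def[symmetric] by (simp add: z_def)
qed

text \<open>The cells of the partition generated by \<open>\<D>\<close> are indexed by the subfamilies \<open>\<S>\<close> of events that
  occur; most of these cells may be empty.\<close>

definition atom :: "'x measure \<Rightarrow> 'x set set \<Rightarrow> 'x set set \<Rightarrow> 'x set" where
  "atom M \<D> \<S> = {x \<in> space M. \<forall>C\<in>\<D>. x \<in> C \<longleftrightarrow> C \<in> \<S>}"

definition family_entropy :: "'x measure \<Rightarrow> 'x set set \<Rightarrow> real" where
  "family_entropy M \<D> = (\<Sum>\<S>\<in>Pow \<D>. neg_x_ln_x (measure M (atom M \<D> \<S>)))"

text \<open>For finite \<open>\<D>\<close> this means that \<open>B\<close> belongs to the algebra generated by \<open>\<D>\<close>.\<close>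

definition determined_by :: "'x measure \<Rightarrow> 'x set set \<Rightarrow> 'x set \<Rightarrow> bool" where
  "determined_by M \<D> B \<longleftrightarrow>
     (\<forall>x\<in>space M. \<forall>y\<in>space M. (\<forall>C\<in>\<D>. x \<in> C \<longleftrightarrow> y \<in> C) \<longrightarrow> (x \<in> B \<longleftrightarrow> y \<in> B))"

lemma determined_by_mono:
  assumes "determined_by M \<D> B" "\<D> \<subseteq> \<E>"
  shows "determined_by M \<E> B"
  unfolding determined_by_def
proof (intro ballI impI)
  fix x y assume "x \<in> space M" "y \<in> space M" "\<forall>C\<in>\<E>. x \<in> C \<longleftrightarrow> y \<in> C"
  moreover from this(3) assms(2) have "\<forall>C\<in>\<D>. x \<in> C \<longleftrightarrow> y \<in> C" by (meson subsetD)
  ultimately show "x \<in> B \<longleftrightarrow> y \<in> B"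
    using assms(1)[unfolded determined_by_def, rule_format, of x y] by blast
qed

lemma atom_in_sets:
  assumes "finite \<D>" "\<D> \<subseteq> sets M"
  shows "atom M \<D> \<S> \<in> sets M"
proof -
  have "{x \<in> space M. x \<in> C \<longleftrightarrow> C \<in> \<S>} \<in> sets M" if "C \<in> \<D>" for C
  proof (cases "C \<in> \<S>")
    case True
    then have "{x \<in> space M. x \<in> C \<longleftrightarrow> C \<in> \<S>} = space M \<inter> C" by auto
    with that assms show ?thesis by auto
  next
    case False
    then have "{x \<in> space M. x \<in> C \<longleftrightarrow> C \<in> \<S>} = space M - C" by auto
    with that assms show ?thesis by auto
  qed
  then show ?thesis
    unfolding atom_def by (intro sets.sets_Collect_finite_All assms)
qed

lemma atom_cases:
  assumes "determined_by M \<D> B"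
  shows "atom M \<D> \<S> \<inter> B = {} \<or> atom M \<D> \<S> - B = {}"
proof (rule ccontr)
  assume "\<not> ?thesis"
  then obtain x y where "x \<in> atom M \<D> \<S>" "x \<in> B" "y \<in> atom M \<D> \<S>" "y \<notin> B"
    by blast
  then have "x \<in> space M" "y \<in> space M" "\<forall>C\<in>\<D>. x \<in> C \<longleftrightarrow> y \<in> C"
    by (simp_all add: atom_def)
  with assms \<open>x \<in> B\<close> \<open>y \<notin> B\<close> show False
    unfolding determined_by_def by metis
qed

context prob_space
begin

lemma neg_x_ln_x_split_determined:
  assumes "determined_by M \<D> B"
  shows "neg_x_ln_x (prob (atom M \<D> \<S> \<inter> B)) + neg_x_ln_x (prob (atom M \<D> \<S> - B)) = neg_x_ln_x (prob (atom M \<D> \<S>))"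
  using atom_cases[OF assms, of \<S>]
proof
  assume *: "atom M \<D> \<S> \<inter> B = {}"
  then have "atom M \<D> \<S> - B = atom M \<D> \<S>" by auto
  with * show ?thesis by simp
next
  assume *: "atom M \<D> \<S> - B = {}"
  then have "atom M \<D> \<S> \<inter> B = atom M \<D> \<S>" by auto
  with * show ?thesis by (simp only: measure_empty neg_x_ln_x_0)
qed

text \<open>Every atom is cut in two by the new event. The formula also covers an event that is already in the
  family, where one of the two pieces is empty; this avoids case distinctions later on.\<close>

lemma family_entropy_insert:
  assumes "finite \<D>" "\<D> \<subseteq> events" "B \<in> events"
  shows "family_entropy M (insert B \<D>) =
    (\<Sum>\<S>\<in>Pow \<D>. neg_x_ln_x (prob (atom M \<D> \<S> \<inter> B)) + neg_x_ln_x (prob (atom M \<D> \<S> - B)))"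
proof (cases "B \<in> \<D>")
  case True
  then have "determined_by M \<D> B" by (simp add: determined_by_def)
  then have "neg_x_ln_x (prob (atom M \<D> \<S> \<inter> B)) + neg_x_ln_x (prob (atom M \<D> \<S> - B)) = neg_x_ln_x (prob (atom M \<D> \<S>))" for \<S>
    by (rule neg_x_ln_x_split_determined)
  with True show ?thesis by (simp add: family_entropy_def insert_absorb)
next
  case False
  have inj: "inj_on (insert B) (Pow \<D>)"
    using False by (intro inj_onI) (meson PowD insert_ident subsetD)
  have disj: "Pow \<D> \<inter> insert B ` Pow \<D> = {}"
    using False by auto
  have 1: "atom M (insert B \<D>) (insert B \<S>) = atom M \<D> \<S> \<inter> B" if "\<S> \<in> Pow \<D>" for \<S>
    using False that by (auto simp: atom_def)
  have 2: "atom M (insert B \<D>) \<S> = atom M \<D> \<S> - B" if "\<S> \<in> Pow \<D>" for \<S>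
    using False that by (auto simp: atom_def)
  have "family_entropy M (insert B \<D>) =
     (\<Sum>\<S>\<in>Pow \<D>. neg_x_ln_x (prob (atom M (insert B \<D>) \<S>))) +
     (\<Sum>\<S>\<in>Pow \<D>. neg_x_ln_x (prob (atom M (insert B \<D>) (insert B \<S>))))"
    unfolding family_entropy_def Pow_insert
    using inj disj assms(1) by (subst sum.union_disjoint) (auto simp: sum.reindex)
  then show ?thesis
    by (simp add: 1 2 sum.distrib)
qed

lemma family_entropy_nonneg: "0 \<le> family_entropy M \<D>"
  unfolding family_entropy_def by (intro sum_nonneg neg_x_ln_x_nonneg measure_nonneg prob_le_1)

lemma family_entropy_empty [simp]: "family_entropy M {} = 0"
  unfolding family_entropy_def atom_def by (simp add: prob_space)

lemma prob_split:
  assumes "A \<in> events" "B \<in> events"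
  shows "prob A = prob (A \<inter> B) + prob (A - B)"
proof -
  have "prob ((A \<inter> B) \<union> (A - B)) = prob (A \<inter> B) + prob (A - B)"
    by (rule finite_measure_Union) (use assms in auto)
  then show ?thesis by (simp add: Int_Diff_Un)
qed

lemma family_entropy_le_insert:
  assumes "finite \<D>" "\<D> \<subseteq> events" "B \<in> events"
  shows "family_entropy M \<D> \<le> family_entropy M (insert B \<D>)"
proof -
  have "neg_x_ln_x (prob (atom M \<D> \<S>)) \<le> neg_x_ln_x (prob (atom M \<D> \<S> \<inter> B)) + neg_x_ln_x (prob (atom M \<D> \<S> - B))" for \<S>
    unfolding prob_split[OF atom_in_sets[OF assms(1,2)] assms(3)]
    by (intro neg_x_ln_x_add_le measure_nonneg)
  then show ?thesis
    unfolding family_entropy_insert[OF assms] unfolding family_entropy_def by (intro sum_mono)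
qed

lemma family_entropy_mono:
  assumes "finite \<E>" "\<E> \<subseteq> events" "\<D> \<subseteq> \<E>"
  shows "family_entropy M \<D> \<le> family_entropy M \<E>"
proof -
  have fin: "finite \<D>" using assms(1,3) finite_subset by blast
  have "finite (\<E> - \<D>)" using assms(1) by simp
  moreover have "\<E> - \<D> \<subseteq> events" using assms(2) by blast
  ultimately have "family_entropy M \<D> \<le> family_entropy M (\<D> \<union> (\<E> - \<D>))"
  proof (induction rule: finite_induct)
    case (insert B X)
    then have "family_entropy M (\<D> \<union> X) \<le> family_entropy M (insert B (\<D> \<union> X))"
      using assms fin by (intro family_entropy_le_insert) auto
    with insert show ?case by auto
  qed simp
  moreover have "\<D> \<union> (\<E> - \<D>) = \<E>" using assms by auto
  ultimately show ?thesis by simp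
qed

lemma family_entropy_insert_determined:
  assumes "finite \<D>" "\<D> \<subseteq> events" "B \<in> events" "determined_by M \<D> B"
  shows "family_entropy M (insert B \<D>) = family_entropy M \<D>"
proof -
  have "neg_x_ln_x (prob (atom M \<D> \<S> \<inter> B)) + neg_x_ln_x (prob (atom M \<D> \<S> - B)) = neg_x_ln_x (prob (atom M \<D> \<S>))" for \<S>
    using neg_x_ln_x_split_determined[OF assms(4)] .
  then show ?thesis
    unfolding family_entropy_insert[OF assms(1-3)] by (simp add: family_entropy_def)
qed

text \<open>Data processing: adding determined events does not refine the partition.\<close>

lemma family_entropy_le_if_determined:
  assumes "finite \<D>" "\<D> \<subseteq> events" "finite \<E>" "\<E> \<subseteq> events"
    and "\<And>B. B \<in> \<E> \<Longrightarrow> determined_by M \<D> B"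
  shows "family_entropy M \<E> \<le> family_entropy M \<D>"
proof -
  have "family_entropy M (\<E> \<union> \<D>) = family_entropy M \<D>"
    using assms(3,4,5)
  proof (induction rule: finite_induct)
    case (insert B X)
    have "family_entropy M (insert B (X \<union> \<D>)) = family_entropy M (X \<union> \<D>)"
      using insert.prems insert.hyps assms determined_by_mono[of M \<D> B "X \<union> \<D>"]
      by (intro family_entropy_insert_determined) auto
    with insert show ?case by auto
  qed simp
  moreover have "family_entropy M \<E> \<le> family_entropy M (\<E> \<union> \<D>)"
    using assms by (intro family_entropy_mono) auto
  ultimately show ?thesis by simp
qed

text \<open>The nonnegativity of conditional mutual information, in a form that involves only two additional
  events: it holds atom by atom, by \<open>neg_x_ln_x_submodular\<close>. Diminishing returns and
  subadditivity follow from it by induction.\<close>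

lemma family_entropy_insert2:
  assumes "finite \<D>" "\<D> \<subseteq> events" "B \<in> events" "C \<in> events"
  shows "family_entropy M (insert B (insert C \<D>)) + family_entropy M \<D>
    \<le> family_entropy M (insert B \<D>) + family_entropy M (insert C \<D>)"
proof (cases "C \<in> \<D>")
  case True
  then show ?thesis by (simp add: insert_absorb)
next
  case False
  let ?h = "\<lambda>A. neg_x_ln_x (prob A)"
  have inj: "inj_on (insert C) (Pow \<D>)"
    using False by (intro inj_onI) (meson PowD insert_ident subsetD)
  have disj: "Pow \<D> \<inter> insert C ` Pow \<D> = {}"
    using False by auto
  have 1: "atom M (insert C \<D>) (insert C \<S>) = atom M \<D> \<S> \<inter> C" if "\<S> \<in> Pow \<D>" for \<S>
    using False that by (auto simp: atom_def)
  have 2: "atom M (insert C \<D>) \<S> = atom M \<D> \<S> - C" if "\<S> \<in> Pow \<D>" for \<S>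
    using False that by (auto simp: atom_def)
  have "family_entropy M (insert B (insert C \<D>)) =
     (\<Sum>\<S>\<in>Pow (insert C \<D>). ?h (atom M (insert C \<D>) \<S> \<inter> B) + ?h (atom M (insert C \<D>) \<S> - B))"
    using assms by (intro family_entropy_insert) auto
  also have "\<dots> = (\<Sum>\<S>\<in>Pow \<D>. ?h (atom M (insert C \<D>) \<S> \<inter> B) + ?h (atom M (insert C \<D>) \<S> - B))
      + (\<Sum>\<S>\<in>Pow \<D>. ?h (atom M (insert C \<D>) (insert C \<S>) \<inter> B) + ?h (atom M (insert C \<D>) (insert C \<S>) - B))"
    unfolding Pow_insert
    using inj disj assms(1) by (subst sum.union_disjoint) (auto simp: sum.reindex)
  also have "\<dots> = (\<Sum>\<S>\<in>Pow \<D>. ?h (atom M \<D> \<S> \<inter> C \<inter> B) + ?h (atom M \<D> \<S> \<inter> C - B)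
      + ?h ((atom M \<D> \<S> - C) \<inter> B) + ?h (atom M \<D> \<S> - C - B))"
    by (simp add: 1 2 sum.distrib)
  finally have lhs: "family_entropy M (insert B (insert C \<D>)) = \<dots>" .
  have "?h (Z \<inter> C \<inter> B) + ?h (Z \<inter> C - B) + ?h ((Z - C) \<inter> B) + ?h (Z - C - B) + ?h Z
    \<le> (?h (Z \<inter> B) + ?h (Z - B)) + (?h (Z \<inter> C) + ?h (Z - C))" if Z: "Z \<in> events" for Z
  proof -
    have "prob Z = prob (Z \<inter> C) + prob (Z - C)" using Z assms by (intro prob_split) auto
    moreover have "prob (Z \<inter> C) = prob (Z \<inter> C \<inter> B) + prob (Z \<inter> C - B)"
      using Z assms by (intro prob_split) auto
    moreover have "prob (Z - C) = prob ((Z - C) \<inter> B) + prob (Z - C - B)"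
      using Z assms by (intro prob_split) auto
    moreover have "prob (Z \<inter> B) = prob (Z \<inter> C \<inter> B) + prob ((Z - C) \<inter> B)"
    proof -
      have "Z \<inter> B \<inter> C = Z \<inter> C \<inter> B" "Z \<inter> B - C = (Z - C) \<inter> B" by auto
      moreover have "prob (Z \<inter> B) = prob (Z \<inter> B \<inter> C) + prob (Z \<inter> B - C)"
        using Z assms by (intro prob_split) auto
      ultimately show ?thesis by simp
    qed
    moreover have "prob (Z - B) = prob (Z \<inter> C - B) + prob (Z - C - B)"
    proof -
      have "(Z - B) \<inter> C = Z \<inter> C - B" "Z - B - C = Z - C - B" by auto
      moreover have "prob (Z - B) = prob ((Z - B) \<inter> C) + prob (Z - B - C)"
        using Z assms by (intro prob_split) auto
      ultimately show ?thesis by simp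
    qed
    ultimately show ?thesis
      using neg_x_ln_x_submodular[of "prob (Z \<inter> C \<inter> B)" "prob (Z \<inter> C - B)" "prob ((Z - C) \<inter> B)" "prob (Z - C - B)"]
      by (simp add: add.assoc)
  qed
  then have "(\<Sum>\<S>\<in>Pow \<D>. (?h (atom M \<D> \<S> \<inter> C \<inter> B) + ?h (atom M \<D> \<S> \<inter> C - B)
      + ?h ((atom M \<D> \<S> - C) \<inter> B) + ?h (atom M \<D> \<S> - C - B)) + ?h (atom M \<D> \<S>))
     \<le> (\<Sum>\<S>\<in>Pow \<D>. (?h (atom M \<D> \<S> \<inter> B) + ?h (atom M \<D> \<S> - B)) + (?h (atom M \<D> \<S> \<inter> C) + ?h (atom M \<D> \<S> - C)))"
    by (intro sum_mono) (simp add: atom_in_sets[OF assms(1,2)])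
  then show ?thesis
    unfolding lhs family_entropy_insert[OF assms(1,2,3)] family_entropy_insert[OF assms(1,2,4)]
    by (simp add: family_entropy_def sum.distrib)
qed

text \<open>Conditioning on more events decreases the conditional entropy of \<open>B\<close>.\<close>

lemma family_entropy_diminishing:
  assumes "finite \<E>" "\<E> \<subseteq> events" "\<D> \<subseteq> \<E>" "B \<in> events"
  shows "family_entropy M (insert B \<E>) - family_entropy M \<E>
    \<le> family_entropy M (insert B \<D>) - family_entropy M \<D>"
proof -
  have fin: "finite \<D>" using assms(1,3) finite_subset by blast
  have "finite (\<E> - \<D>)" using assms(1) by simp
  moreover have "\<E> - \<D> \<subseteq> events" using assms(2) by blast
  ultimately have "family_entropy M (insert B ((\<E> - \<D>) \<union> \<D>)) - family_entropy M ((\<E> - \<D>) \<union> \<D>)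
    \<le> family_entropy M (insert B \<D>) - family_entropy M \<D>"
  proof (induction rule: finite_induct)
    case (insert C X)
    then have "family_entropy M (insert B (insert C (X \<union> \<D>))) + family_entropy M (X \<union> \<D>)
      \<le> family_entropy M (insert B (X \<union> \<D>)) + family_entropy M (insert C (X \<union> \<D>))"
      using assms fin by (intro family_entropy_insert2) auto
    with insert show ?case by auto
  qed simp
  moreover have "(\<E> - \<D>) \<union> \<D> = \<E>" using assms by auto
  ultimately show ?thesis by simp
qed

lemma family_entropy_insert_le:
  assumes "finite \<D>" "\<D> \<subseteq> events" "B \<in> events"
  shows "family_entropy M (insert B \<D>) \<le> family_entropy M \<D> + family_entropy M {B}"
  using family_entropy_diminishing[OF assms(1,2) empty_subsetI assms(3)] by simp

lemma family_entropy_Un_le: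
  assumes "finite \<D>" "\<D> \<subseteq> events" "finite \<E>" "\<E> \<subseteq> events"
  shows "family_entropy M (\<D> \<union> \<E>) \<le> family_entropy M \<D> + family_entropy M \<E>"
  using assms(1,2)
proof (induction rule: finite_induct)
  case (insert B X)
  then have "family_entropy M (insert B (X \<union> \<E>)) - family_entropy M (X \<union> \<E>)
      \<le> family_entropy M (insert B X) - family_entropy M X"
    using assms by (intro family_entropy_diminishing) auto
  with insert show ?case by auto
qed simp

lemma family_entropy_Un_image_le:
  assumes "finite \<D>" "\<D> \<subseteq> events" "finite I" "\<And>i. i \<in> I \<Longrightarrow> B i \<in> events"
    and "\<And>i. i \<in> I \<Longrightarrow> family_entropy M {B i} \<le> c"
  shows "family_entropy M (B ` I \<union> \<D>) \<le> family_entropy M \<D> + real (card I) * c"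
  using assms(3-5)
proof (induction rule: finite_induct)
  case (insert i I)
  have "family_entropy M (insert (B i) (B ` I \<union> \<D>)) \<le> family_entropy M (B ` I \<union> \<D>) + family_entropy M {B i}"
    using insert assms by (intro family_entropy_insert_le) auto
  moreover have "family_entropy M (B ` I \<union> \<D>) \<le> family_entropy M \<D> + real (card I) * c"
    using insert by simp
  moreover have "family_entropy M {B i} \<le> c"
    using insert by simp
  ultimately show ?case
    using insert.hyps by (simp add: algebra_simps)
qed simp

lemma family_entropy_singleton:
  assumes "B \<in> events"
  shows "family_entropy M {B} = neg_x_ln_x (prob B) + neg_x_ln_x (1 - prob B)"
proof -
  have "atom M {} {} = space M" by (simp add: atom_def)
  then show ?thesis
    using family_entropy_insert[of "{}" B] assms sets.sets_into_space[OF assms]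
    by (simp add: prob_compl Int_absorb1)
qed

lemma family_entropy_singleton_le_2:
  assumes "B \<in> events"
  shows "family_entropy M {B} \<le> 2"
  using neg_x_ln_x_le_one_minus[of "prob B"] neg_x_ln_x_le_one_minus[of "1 - prob B"]
  by (simp add: family_entropy_singleton[OF assms])

lemma family_entropy_singleton_le_sqrt:
  assumes "B \<in> events"
  shows "family_entropy M {B} \<le> 3 * sqrt (prob B)"
proof -
  have "(prob B)\<^sup>2 \<le> prob B" by (simp add: power2_eq_square mult_left_le)
  then have "prob B \<le> sqrt (prob B)" by (rule real_le_rsqrt)
  then show ?thesis
    using neg_x_ln_x_le_sqrt[of "prob B"] neg_x_ln_x_le_one_minus[of "1 - prob B"]
    by (simp add: family_entropy_singleton[OF assms])
qed

end

section \<open>Multiple covers and Folner sequences\<close>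

text \<open>Shearer's inequality for an arbitrary set function with diminishing returns. Build up \<open>F\<close> one
  element at a time: when \<open>b\<close> is added, the \<open>k\<close> traces \<open>T i \<inter> F\<close> of the sets \<open>T i\<close> that contain
  \<open>b\<close> gain at least as much as the whole set does, being smaller.\<close>

lemma shearer_inequality:
  fixes h :: "'g set \<Rightarrow> real"
  assumes diminishing: "\<And>D E b. D \<subseteq> E \<Longrightarrow> E \<subseteq> F \<Longrightarrow> b \<in> F \<Longrightarrow> h (insert b E) - h E \<le> h (insert b D) - h D"
    and empty: "h {} = 0"
    and fin: "finite F" "finite I"
    and cover: "\<And>b. b \<in> F \<Longrightarrow> card {i \<in> I. b \<in> T i} = k"
  shows "real k * h F \<le> (\<Sum>i\<in>I. h (T i \<inter> F))"
proof -
  have "E \<subseteq> F \<Longrightarrow> real k * h E \<le> (\<Sum>i\<in>I. h (T i \<inter> E))" if "finite E" for E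
    using that
  proof (induction rule: finite_induct)
    case empty
    then show ?case by (simp add: assms(2))
  next
    case (insert b E)
    have step: "h (T i \<inter> E) + (if b \<in> T i then h (insert b E) - h E else 0) \<le> h (T i \<inter> insert b E)" for i
    proof (cases "b \<in> T i")
      case True
      then have "T i \<inter> insert b E = insert b (T i \<inter> E)" by auto
      with True diminishing[of "T i \<inter> E" E b] insert.prems show ?thesis by auto
    next
      case False
      then have "T i \<inter> insert b E = T i \<inter> E" by auto
      with False show ?thesis by simp
    qed
    have "real k * h (insert b E) = real k * h E + real k * (h (insert b E) - h E)"
      by (simp add: algebra_simps)
    also have "\<dots> \<le> (\<Sum>i\<in>I. h (T i \<inter> E)) + real k * (h (insert b E) - h E)"
      using insert by simp
    also have "real k * (h (insert b E) - h E) = (\<Sum>i\<in>I. if b \<in> T i then h (insert b E) - h E else 0)"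
      using cover[of b] insert.prems fin by (simp add: sum.If_cases Int_def conj_commute)
    also have "(\<Sum>i\<in>I. h (T i \<inter> E)) + \<dots> \<le> (\<Sum>i\<in>I. h (T i \<inter> insert b E))"
      unfolding sum.distrib[symmetric] by (intro sum_mono step)
    finally show ?case .
  qed
  from this[OF fin(1)] show ?thesis by simp
qed

lemma folner_sequenceD:
  assumes "folner_sequence G F"
  shows "F n \<subseteq> carrier G" "finite (F n)" "F n \<noteq> {}" "card (F n) > 0"
  using assms unfolding folner_sequence_def by (auto simp: card_gt_0_iff)

lemma finite_l_coset [simp]: "finite F \<Longrightarrow> finite (g <#\<^bsub>G\<^esub> F)"
  by (simp add: l_coset_def)

text \<open>Left multiplication by a fixed finite set enlarges the sets of a Folner sequence only by a factor
  that tends to \<open>1\<close>.\<close>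

lemma folner_sequence_product:
  assumes "folner_sequence G F" "finite K" "K \<subseteq> carrier G"
  obtains \<delta> where "\<delta> \<longlonglongrightarrow> (0::real)"
    "\<And>n. real (card (\<Union>k\<in>K. k <#\<^bsub>G\<^esub> F n)) \<le> (1 + \<delta> n) * real (card (F n))"
proof -
  define D where "D k n = ((k <#\<^bsub>G\<^esub> F n) - F n) \<union> (F n - (k <#\<^bsub>G\<^esub> F n))" for k n
  note F = folner_sequenceD[OF assms(1)]
  have "(\<lambda>n. \<Sum>k\<in>K. real (card (D k n)) / real (card (F n))) \<longlonglongrightarrow> (\<Sum>k\<in>K. 0)"
    using assms unfolding folner_sequence_def D_def by (intro tendsto_sum) auto
  moreover have "real (card (\<Union>k\<in>K. k <#\<^bsub>G\<^esub> F n))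
    \<le> (1 + (\<Sum>k\<in>K. real (card (D k n)) / real (card (F n)))) * real (card (F n))" for n
  proof -
    have fin: "finite (D k n)" for k
      using F by (simp add: D_def)
    have "(\<Union>k\<in>K. k <#\<^bsub>G\<^esub> F n) \<subseteq> F n \<union> (\<Union>k\<in>K. D k n)"
      by (auto simp: D_def)
    then have "card (\<Union>k\<in>K. k <#\<^bsub>G\<^esub> F n) \<le> card (F n \<union> (\<Union>k\<in>K. D k n))"
      using F fin assms by (intro card_mono) auto
    also have "\<dots> \<le> card (F n) + card (\<Union>k\<in>K. D k n)"
      by (rule card_Un_le)
    also have "\<dots> \<le> card (F n) + (\<Sum>k\<in>K. card (D k n))"
      using assms by (intro add_left_mono card_UN_le)
    finally have "real (card (\<Union>k\<in>K. k <#\<^bsub>G\<^esub> F n)) \<le> real (card (F n)) + (\<Sum>k\<in>K. real (card (D k n)))"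
      by (metis of_nat_add of_nat_le_iff of_nat_sum)
    also have "\<dots> = (1 + (\<Sum>k\<in>K. real (card (D k n)) / real (card (F n)))) * real (card (F n))"
      using F(4)[of n] by (simp add: sum_divide_distrib[symmetric] field_simps)
    finally show ?thesis .
  qed
  ultimately show thesis
    by (intro that[of "\<lambda>n. \<Sum>k\<in>K. real (card (D k n)) / real (card (F n))"]) auto
qed

section \<open>Entropy per group element\<close>

text \<open>The setting in which all of the dynamics takes place: measure-preserving transformations of the
  whole type that compose like the group.
  The topological system enters through its completed measure, which is an instance.\<close>

locale mp_action = prob_space M + group G
  for M :: "'x measure" and G :: "('g, 'b) monoid_scheme" (structure) and \<phi> :: "'g \<Rightarrow> 'x \<Rightarrow> 'x" +
  assumes space_UNIV: "space M = UNIV"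
    and act_measurable [measurable]: "g \<in> carrier G \<Longrightarrow> \<phi> g \<in> measurable M M"
    and act_prob: "g \<in> carrier G \<Longrightarrow> A \<in> events \<Longrightarrow> prob (\<phi> g -` A) = prob A"
    and act_mult: "g \<in> carrier G \<Longrightarrow> h \<in> carrier G \<Longrightarrow> \<phi> (g \<otimes> h) x = \<phi> g (\<phi> h x)"
    and act_one: "\<phi> \<one> x = x"
begin

lemma act_vimage_events: "g \<in> carrier G \<Longrightarrow> A \<in> events \<Longrightarrow> \<phi> g -` A \<in> events"
  using measurable_sets[OF act_measurable] by (simp add: space_UNIV)

lemma act_surj: "g \<in> carrier G \<Longrightarrow> surj (\<phi> g)"
  by (metis act_mult act_one inv_closed r_inv surjI)

text \<open>The translates generate the join of the partitions \<open>{\<phi> g -` A, UNIV - \<phi> g -` A}\<close>, so their joint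
  entropy is the entropy that occurs in the definition of dynamical entropy. Distinct \<open>g\<close> may yield
  the same translate; a repetition does not refine the join, so a set of events suffices.\<close>

definition translates :: "'x set \<Rightarrow> 'g set \<Rightarrow> 'x set set" where
  "translates A F = (\<lambda>g. \<phi> g -` A) ` F"

definition orbit_entropy :: "'x set \<Rightarrow> 'g set \<Rightarrow> real" where
  "orbit_entropy A F = family_entropy M (translates A F)"

lemma translates_events: "A \<in> events \<Longrightarrow> F \<subseteq> carrier G \<Longrightarrow> translates A F \<subseteq> events"
  unfolding translates_def using act_vimage_events by auto

lemma finite_translates: "finite F \<Longrightarrow> finite (translates A F)"
  unfolding translates_def by simp

lemma orbit_entropy_nonneg: "0 \<le> orbit_entropy A F"
  unfolding orbit_entropy_def by (rule family_entropy_nonneg)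

lemma orbit_entropy_mono:
  assumes "A \<in> events" "F \<subseteq> carrier G" "finite F" "E \<subseteq> F"
  shows "orbit_entropy A E \<le> orbit_entropy A F"
  unfolding orbit_entropy_def using assms
  by (intro family_entropy_mono translates_events finite_translates) (auto simp: translates_def)

text \<open>Since \<open>\<phi> g\<close> is surjective, taking preimages is injective on sets, so that the atoms of the two
  families correspond bijectively and have equal probabilities.\<close>

lemma family_entropy_act_vimage:
  assumes g: "g \<in> carrier G" and D: "finite D" "D \<subseteq> events"
  shows "family_entropy M ((\<lambda>B. \<phi> g -` B) ` D) = family_entropy M D"
proof -
  let ?V = "\<lambda>B. \<phi> g -` B"
  have inj: "inj ?V"
    using act_surj[OF g] by (intro injI) (metis surj_image_vimage_eq)
  have atom: "atom M (?V ` D) (?V ` S) = \<phi> g -` atom M D S" for S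
    using inj by (simp add: atom_def space_UNIV vimage_def inj_image_mem_iff[OF inj, unfolded vimage_def])
  have "inj_on (image ?V) (Pow D)"
    using inj by (intro inj_on_image_Pow inj_on_subset[OF inj]) auto
  then have "family_entropy M (?V ` D) = (\<Sum>S\<in>Pow D. neg_x_ln_x (prob (atom M (?V ` D) (?V ` S))))"
    unfolding family_entropy_def image_Pow_surj[OF refl, of ?V D, symmetric] by (simp add: sum.reindex)
  also have "\<dots> = (\<Sum>S\<in>Pow D. neg_x_ln_x (prob (atom M D S)))"
    unfolding atom using act_prob[OF g atom_in_sets[OF D]] by simp
  finally show ?thesis by (simp add: family_entropy_def)
qed

lemma orbit_entropy_right_translate:
  assumes "A \<in> events" "finite F" "F \<subseteq> carrier G" "h \<in> carrier G"
  shows "orbit_entropy A ((\<lambda>g. g \<otimes> h) ` F) = orbit_entropy A F"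
proof -
  have "\<phi> (g \<otimes> h) -` A = \<phi> h -` (\<phi> g -` A)" if "g \<in> F" for g
    using that assms by (auto simp: act_mult)
  then have "translates A ((\<lambda>g. g \<otimes> h) ` F) = (\<lambda>B. \<phi> h -` B) ` translates A F"
    unfolding translates_def image_image by (intro image_cong) auto
  then show ?thesis
    unfolding orbit_entropy_def
    using assms by (simp add: family_entropy_act_vimage finite_translates translates_events)
qed

text \<open>The right translates of \<open>K\<close> that meet \<open>F\<close> are those by elements of \<open>inv K F\<close>, and they cover every
  element of \<open>F\<close> exactly \<open>card K\<close> times. By monotonicity and invariance, the trace of each of them on
  \<open>F\<close> has at most the entropy of \<open>K\<close>.\<close>

lemma orbit_entropy_shearer:
  assumes A: "A \<in> events" and F: "finite F" "F \<subseteq> carrier G" and K: "finite K" "K \<subseteq> carrier G"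
  shows "real (card K) * orbit_entropy A F \<le> real (card (\<Union>k\<in>K. inv k <# F)) * orbit_entropy A K"
proof -
  define I where "I = (\<Union>k\<in>K. inv k <# F)"
  define T where "T g = (\<lambda>k. k \<otimes> g) ` K" for g
  have I: "finite I" "I \<subseteq> carrier G"
    using F K by (auto simp: I_def l_coset_def)
  have "real (card K) * orbit_entropy A F \<le> (\<Sum>g\<in>I. orbit_entropy A (T g \<inter> F))"
  proof (rule shearer_inequality)
    fix D E b assume "D \<subseteq> E" "E \<subseteq> F" "b \<in> F"
    then have "finite E" "E \<subseteq> carrier G" "b \<in> carrier G"
      using F finite_subset by auto
    then show "orbit_entropy A (insert b E) - orbit_entropy A E
      \<le> orbit_entropy A (insert b D) - orbit_entropy A D"
      unfolding orbit_entropy_def translates_def image_insert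
      using \<open>D \<subseteq> E\<close> A translates_events[OF A \<open>E \<subseteq> carrier G\<close>]
      by (intro family_entropy_diminishing) (auto simp: translates_def act_vimage_events)
  next
    fix b assume b: "b \<in> F"
    have "{g \<in> I. b \<in> T g} = (\<lambda>k. inv k \<otimes> b) ` K"
    proof (intro equalityI subsetI)
      fix g assume "g \<in> {g \<in> I. b \<in> T g}"
      then obtain k where k: "k \<in> K" "b = k \<otimes> g" "g \<in> carrier G" using I by (auto simp: T_def)
      then have "g = inv k \<otimes> b" using K by (simp add: m_assoc[symmetric] subsetD)
      with k show "g \<in> (\<lambda>k. inv k \<otimes> b) ` K" by auto
    next
      fix g assume "g \<in> (\<lambda>k. inv k \<otimes> b) ` K"
      then obtain k where k: "k \<in> K" "g = inv k \<otimes> b" by auto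
      then have "k \<otimes> g = b" using K F b by (simp add: m_assoc[symmetric] subsetD)
      then have "b \<in> T g" using k(1) by (auto simp: T_def intro!: rev_image_eqI)
      with k b show "g \<in> {g \<in> I. b \<in> T g}"
        by (auto simp: I_def l_coset_def)
    qed
    moreover have "inj_on (\<lambda>k. inv k \<otimes> b) K"
      using K F b by (intro inj_onI) (metis inv_inv inv_closed right_cancel subsetD)
    ultimately show "card {g \<in> I. b \<in> T g} = card K"
      by (simp add: card_image)
  qed (use F I in \<open>auto simp: orbit_entropy_def translates_def\<close>)
  also have "\<dots> \<le> (\<Sum>g\<in>I. orbit_entropy A K)"
  proof (rule sum_mono)
    fix g assume "g \<in> I"
    then have g: "g \<in> carrier G" using I by auto
    then have "orbit_entropy A (T g \<inter> F) \<le> orbit_entropy A (T g)"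
      using A K by (intro orbit_entropy_mono) (auto simp: T_def)
    also have "\<dots> = orbit_entropy A K"
      unfolding T_def using A K g by (intro orbit_entropy_right_translate)
    finally show "orbit_entropy A (T g \<inter> F) \<le> orbit_entropy A K" .
  qed
  finally show ?thesis by (simp add: I_def)
qed

definition entropy_rate :: "'x set \<Rightarrow> real" where
  "entropy_rate A = (INF K\<in>{K. finite K \<and> K \<noteq> {} \<and> K \<subseteq> carrier G}. orbit_entropy A K / real (card K))"

lemma entropy_rate_le:
  assumes "finite K" "K \<noteq> {}" "K \<subseteq> carrier G"
  shows "entropy_rate A \<le> orbit_entropy A K / real (card K)"
  unfolding entropy_rate_def using assms
  by (intro cINF_lower bdd_belowI[of _ 0]) (auto simp: orbit_entropy_nonneg)

lemma entropy_rate_nonneg: "0 \<le> entropy_rate A"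
  unfolding entropy_rate_def
  by (intro cINF_greatest) (auto simp: orbit_entropy_nonneg intro!: exI[of _ "{\<one>}"])

lemma entropy_rate_lessD:
  assumes "entropy_rate A < c"
  obtains K where "finite K" "K \<noteq> {}" "K \<subseteq> carrier G" "orbit_entropy A K / real (card K) < c"
proof -
  have "\<exists>K\<in>{K. finite K \<and> K \<noteq> {} \<and> K \<subseteq> carrier G}. orbit_entropy A K / real (card K) < c"
    using assms unfolding entropy_rate_def
    by (subst (asm) cINF_less_iff) (auto intro!: bdd_belowI[of _ 0] exI[of _ "{\<one>}"] simp: orbit_entropy_nonneg)
  with that show thesis by auto
qed

text \<open>The infimum is a lower bound for all finite sets. Conversely, a near-optimal \<open>K\<close> imposes its value on
  the sets of a Folner sequence, since \<open>card (inv K F) / card F\<close> tends to \<open>1\<close> in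
  \<open>orbit_entropy_shearer\<close>. In particular the limit does not depend on the Folner sequence.\<close>

theorem orbit_entropy_tendsto_rate:
  assumes "folner_sequence G F" "A \<in> events"
  shows "(\<lambda>n. orbit_entropy A (F n) / real (card (F n))) \<longlonglongrightarrow> entropy_rate A"
proof (rule order_tendstoI)
  note F = folner_sequenceD[OF assms(1)]
  fix c assume "c < entropy_rate A"
  then have "c < orbit_entropy A (F n) / real (card (F n))" for n
    using entropy_rate_le[OF F(2,3,1)] by (rule order_less_le_trans)
  then show "eventually (\<lambda>n. c < orbit_entropy A (F n) / real (card (F n))) sequentially"
    by simp
next
  note F = folner_sequenceD[OF assms(1)]
  fix c assume "entropy_rate A < c"
  then obtain K where K: "finite K" "K \<noteq> {}" "K \<subseteq> carrier G" "orbit_entropy A K / real (card K) < c"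
    by (rule entropy_rate_lessD)
  have "finite ((\<lambda>k. inv k) ` K)" "(\<lambda>k. inv k) ` K \<subseteq> carrier G"
    using K by auto
  then obtain \<delta> where \<delta>: "\<delta> \<longlonglongrightarrow> (0::real)"
    "\<And>n. real (card (\<Union>k\<in>(\<lambda>k. inv k) ` K. k <# F n)) \<le> (1 + \<delta> n) * real (card (F n))"
    using folner_sequence_product[OF assms(1)] by metis
  have "(\<lambda>n. (1 + \<delta> n) * (orbit_entropy A K / real (card K))) \<longlonglongrightarrow> (1 + 0) * (orbit_entropy A K / real (card K))"
    by (intro tendsto_intros \<delta>)
  then have "eventually (\<lambda>n. (1 + \<delta> n) * (orbit_entropy A K / real (card K)) < c) sequentially"
    using K(4) by (intro order_tendstoD) auto
  moreover have "orbit_entropy A (F n) / real (card (F n)) \<le> (1 + \<delta> n) * (orbit_entropy A K / real (card K))" for n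
  proof -
    have cK: "real (card K) > 0" using K by (simp add: card_gt_0_iff)
    have "real (card K) * orbit_entropy A (F n) \<le> real (card (\<Union>k\<in>K. inv k <# F n)) * orbit_entropy A K"
      using assms F K by (intro orbit_entropy_shearer)
    also have "\<dots> \<le> ((1 + \<delta> n) * real (card (F n))) * orbit_entropy A K"
      using \<delta>(2)[of n] by (intro mult_right_mono orbit_entropy_nonneg) simp
    finally show ?thesis
      using cK F(4)[of n] by (simp add: field_simps)
  qed
  ultimately show "eventually (\<lambda>n. orbit_entropy A (F n) / real (card (F n)) < c) sequentially"
    by (auto elim!: eventually_mono intro: order_le_less_trans)
qed

text \<open>The join of partitions and the atoms of the translates have the same nonempty cells, namely the
  sets of points with a prescribed itinerary along \<open>F\<close>. Empty cells contribute nothing, but the two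
  descriptions index them differently.\<close>

lemma partition_entropy_eq_orbit_entropy:
  assumes A: "A \<in> events" and F: "finite F" "F \<subseteq> carrier G"
  shows "partition_entropy M (partition_join F (\<lambda>g. (\<lambda>A. \<phi> g -` A) ` {A, space M - A})) = orbit_entropy A F"
proof -
  \<comment> \<open>the points with the same itinerary along \<open>F\<close> as \<open>x\<close>\<close>
  define cell where "cell x = {y. \<forall>g\<in>F. \<phi> g y \<in> A \<longleftrightarrow> \<phi> g x \<in> A}" for x
  let ?J = "partition_join F (\<lambda>g. (\<lambda>A. \<phi> g -` A) ` {A, space M - A})"
  let ?D = "translates A F"
  have mem_cell: "x \<in> cell x" for x by (simp add: cell_def)
  have finJ: "finite ?J"
  proof -
    have "?J = (\<lambda>a. \<Inter>i\<in>F. a i) ` (\<Pi>\<^sub>E g\<in>F. (\<lambda>A. \<phi> g -` A) ` {A, space M - A})"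
      by (auto simp: partition_join_def)
    then show ?thesis using F by (auto intro!: finite_PiE)
  qed
  have J: "?J - {{}} = range cell"
  proof (intro equalityI subsetI)
    fix Z assume "Z \<in> ?J - {{}}"
    then obtain a where "Z = (\<Inter>g\<in>F. a g)" "a \<in> (\<Pi>\<^sub>E g\<in>F. (\<lambda>A. \<phi> g -` A) ` {A, space M - A})" "Z \<noteq> {}"
      unfolding partition_join_def by blast
    then obtain x where a: "Z = (\<Inter>g\<in>F. a g)" "a \<in> (\<Pi>\<^sub>E g\<in>F. (\<lambda>A. \<phi> g -` A) ` {A, space M - A})" "x \<in> Z"
      by blast
    have "y \<in> a g \<longleftrightarrow> (\<phi> g y \<in> A \<longleftrightarrow> \<phi> g x \<in> A)" if "g \<in> F" for g y
    proof -
      have "a g = \<phi> g -` A \<or> a g = \<phi> g -` (space M - A)" "x \<in> a g"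
        using that a by (auto simp: PiE_iff)
      then show ?thesis by (auto simp: space_UNIV)
    qed
    then have "Z = cell x" unfolding a(1) cell_def by auto
    then show "Z \<in> range cell" by auto
  next
    fix Z assume "Z \<in> range cell"
    then obtain x where x: "Z = cell x" by auto
    define a where "a = (\<lambda>g\<in>F. if \<phi> g x \<in> A then \<phi> g -` A else \<phi> g -` (space M - A))"
    have "a \<in> (\<Pi>\<^sub>E g\<in>F. (\<lambda>A. \<phi> g -` A) ` {A, space M - A})" by (auto simp: a_def)
    moreover have "Z = (\<Inter>g\<in>F. a g)"
      by (auto simp: x cell_def a_def space_UNIV split: if_splits)
    ultimately show "Z \<in> ?J - {{}}" using mem_cell[of x] x by (auto simp: partition_join_def)
  qed
  have D: "atom M ?D ` {S \<in> Pow ?D. atom M ?D S \<noteq> {}} = range cell"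
  proof (intro equalityI subsetI)
    fix Z assume "Z \<in> atom M ?D ` {S \<in> Pow ?D. atom M ?D S \<noteq> {}}"
    then obtain S x where S: "S \<subseteq> ?D" "Z = atom M ?D S" "x \<in> Z" by auto
    have "y \<in> Z \<longleftrightarrow> (\<forall>g\<in>F. \<phi> g y \<in> A \<longleftrightarrow> \<phi> g -` A \<in> S)" for y
      unfolding S(2) by (simp add: atom_def space_UNIV translates_def)
    with S(3) have "Z = cell x" by (auto simp: cell_def)
    then show "Z \<in> range cell" by auto
  next
    fix Z assume "Z \<in> range cell"
    then obtain x where x: "Z = cell x" by auto
    have "cell x = atom M ?D {C \<in> ?D. x \<in> C}"
      by (auto simp: cell_def atom_def space_UNIV translates_def)
    with x mem_cell[of x] show "Z \<in> atom M ?D ` {S \<in> Pow ?D. atom M ?D S \<noteq> {}}" by blast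
  qed
  have inj: "inj_on (atom M ?D) {S \<in> Pow ?D. atom M ?D S \<noteq> {}}"
  proof (rule inj_onI)
    fix S S' assume S: "S \<in> {S \<in> Pow ?D. atom M ?D S \<noteq> {}}" "S' \<in> {S \<in> Pow ?D. atom M ?D S \<noteq> {}}"
      "atom M ?D S = atom M ?D S'"
    then obtain x where x: "x \<in> atom M ?D S" "x \<in> atom M ?D S'" by auto
    have "S = {C \<in> ?D. x \<in> C}" using S(1) x(1) by (auto simp: atom_def)
    moreover have "S' = {C \<in> ?D. x \<in> C}" using S(2) x(2) by (auto simp: atom_def)
    ultimately show "S = S'" by simp
  qed
  have "partition_entropy M ?J = (\<Sum>Z\<in>?J. neg_x_ln_x (prob Z))"
    by (simp add: partition_entropy_def neg_x_ln_x_def sum_negf)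
  also have "\<dots> = (\<Sum>Z\<in>range cell. neg_x_ln_x (prob Z))"
    unfolding J[symmetric] using finJ by (intro sum.mono_neutral_right) auto
  also have "\<dots> = (\<Sum>S\<in>{S \<in> Pow ?D. atom M ?D S \<noteq> {}}. neg_x_ln_x (prob (atom M ?D S)))"
    unfolding D[symmetric] by (subst sum.reindex[OF inj]) simp
  also have "\<dots> = (\<Sum>S\<in>Pow ?D. neg_x_ln_x (prob (atom M ?D S)))"
    using finite_translates[OF F(1)] by (intro sum.mono_neutral_left) auto
  finally show ?thesis by (simp add: orbit_entropy_def family_entropy_def)
qed

text \<open>The definite description in the dynamical entropy is meaningful because the limit exists and
  is the same for all Folner sequences, of which amenability provides at least one.\<close>

lemma dynamical_entropy_eq_rate:
  assumes "amenable G" "A \<in> events"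
  shows "dynamical_entropy G \<phi> M {A, space M - A} = entropy_rate A"
  unfolding dynamical_entropy_def
proof (rule the_equality)
  have eq: "partition_entropy M (partition_join (F n) (\<lambda>g. (\<lambda>A. \<phi> g -` A) ` {A, space M - A})) = orbit_entropy A (F n)"
    if "folner_sequence G F" for F n
    using folner_sequenceD[OF that] assms by (intro partition_entropy_eq_orbit_entropy)
  show "\<forall>F. folner_sequence G F \<longrightarrow> (\<lambda>n. partition_entropy M (partition_join (F n) (\<lambda>g. (\<lambda>A. \<phi> g -` A) ` {A, space M - A})) / real (card (F n))) \<longlonglongrightarrow> entropy_rate A"
    using orbit_entropy_tendsto_rate[OF _ assms(2)] eq by simp
  fix h assume h: "\<forall>F. folner_sequence G F \<longrightarrow> (\<lambda>n. partition_entropy M (partition_join (F n) (\<lambda>g. (\<lambda>A. \<phi> g -` A) ` {A, space M - A})) / real (card (F n))) \<longlonglongrightarrow> h"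
  obtain F where F: "folner_sequence G F" using assms by (auto simp: amenable_def)
  then have "(\<lambda>n. orbit_entropy A (F n) / real (card (F n))) \<longlonglongrightarrow> h"
    using h eq[OF F] by auto
  then show "h = entropy_rate A"
    using orbit_entropy_tendsto_rate[OF F assms(2)] by (rule LIMSEQ_unique)
qed

lemma pinsker_algebra_iff:
  assumes "amenable G"
  shows "A \<in> pinsker_algebra G \<phi> M \<longleftrightarrow> A \<in> events \<and> entropy_rate A = 0"
  using dynamical_entropy_eq_rate[OF assms] by (auto simp: pinsker_algebra_def)

end

section \<open>The Pinsker algebra as an invariant \<open>\<sigma>\<close>-algebra\<close>

lemma determined_by_vimage:
  assumes "determined_by M \<D> B" "space M = UNIV"
  shows "determined_by M ((\<lambda>C. f -` C) ` \<D>) (f -` B)"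
  unfolding determined_by_def
proof (intro ballI impI)
  fix x y assume "\<forall>C\<in>(\<lambda>C. f -` C) ` \<D>. x \<in> C \<longleftrightarrow> y \<in> C"
  then have "\<forall>C\<in>\<D>. f x \<in> C \<longleftrightarrow> f y \<in> C" by simp
  with assms show "x \<in> f -` B \<longleftrightarrow> y \<in> f -` B"
    by (simp add: determined_by_def)
qed

context mp_action
begin

lemma entropy_rate_eq_0I:
  assumes "\<And>\<epsilon>. \<epsilon> > 0 \<Longrightarrow> \<exists>K. finite K \<and> K \<noteq> {} \<and> K \<subseteq> carrier G \<and> orbit_entropy A K \<le> \<epsilon> * real (card K)"
  shows "entropy_rate A = 0"
proof -
  have "entropy_rate A \<le> \<epsilon>" if \<epsilon>: "\<epsilon> > 0" for \<epsilon>
  proof -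
    from assms[OF \<epsilon>] obtain K where K: "finite K" "K \<noteq> {}" "K \<subseteq> carrier G"
      "orbit_entropy A K \<le> \<epsilon> * real (card K)" by blast
    then have "orbit_entropy A K / real (card K) \<le> \<epsilon>"
      by (simp add: divide_le_eq card_gt_0_iff)
    with entropy_rate_le[OF K(1-3)] show ?thesis by (rule order_trans)
  qed
  then have "entropy_rate A \<le> 0" by (rule field_le_epsilon[where y = 0, simplified])
  with entropy_rate_nonneg[of A] show ?thesis by simp
qed

lemma vimage_determined:
  assumes D: "determined_by M \<D> A" and sub: "\<And>B. B \<in> \<D> \<Longrightarrow> \<phi> g -` B \<in> \<E>"
  shows "determined_by M \<E> (\<phi> g -` A)"
  by (rule determined_by_mono[OF determined_by_vimage[OF D space_UNIV]], rule image_subsetI, rule sub)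

text \<open>The union differs from a finite subunion by an event \<open>R\<close> of small probability, so its translates are
  determined by those of finitely many \<open>A i\<close>, whose entropy per element is small along a Folner
  sequence, together with the translates of \<open>R\<close>, each of which has small entropy.\<close>

lemma entropy_rate_UN_eq_0:
  fixes A :: "nat \<Rightarrow> 'x set"
  assumes am: "amenable G" and A: "\<And>i. A i \<in> events" and zero: "\<And>i. entropy_rate (A i) = 0"
  shows "entropy_rate (\<Union>i. A i) = 0"
proof (rule entropy_rate_eq_0I)
  fix \<epsilon> :: real assume \<epsilon>: "\<epsilon> > 0"
  obtain F where F': "folner_sequence G F" using am by (auto simp: amenable_def)
  note F = folner_sequenceD[OF F']
  have "(\<lambda>n. prob ((\<Union>i. A i) - (\<Union>i<n. A i))) \<longlonglongrightarrow> prob (\<Inter>n. (\<Union>i. A i) - (\<Union>i<n. A i))"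
  proof (rule finite_Lim_measure_decseq)
    show "range (\<lambda>n. (\<Union>i. A i) - (\<Union>i<n. A i)) \<subseteq> events" using A by auto
    show "decseq (\<lambda>n. (\<Union>i. A i) - (\<Union>i<n. A i))"
      by (rule decseq_SucI) (auto simp: less_Suc_eq)
  qed
  moreover have "(\<Inter>n. (\<Union>i. A i) - (\<Union>i<n. A i)) = {}" by auto
  ultimately have "(\<lambda>n. prob ((\<Union>i. A i) - (\<Union>i<n. A i))) \<longlonglongrightarrow> 0"
    by (simp only: measure_empty)
  then have "(\<lambda>n. 3 * sqrt (prob ((\<Union>i. A i) - (\<Union>i<n. A i)))) \<longlonglongrightarrow> 3 * sqrt 0"
    by (intro tendsto_intros)
  then have "eventually (\<lambda>n. 3 * sqrt (prob ((\<Union>i. A i) - (\<Union>i<n. A i))) < \<epsilon> / 2) sequentially"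
    by (rule order_tendstoD) (use \<epsilon> in simp)
  then obtain N where N: "3 * sqrt (prob ((\<Union>i. A i) - (\<Union>i<N. A i))) < \<epsilon> / 2"
    by (auto simp: eventually_sequentially)
  let ?B = "(\<Union>i. A i)" and ?R = "(\<Union>i. A i) - (\<Union>i<N. A i)"
  have R: "?R \<in> events" "?B \<in> events" using A by auto
  have "(\<lambda>n. \<Sum>i<N. orbit_entropy (A i) (F n) / real (card (F n))) \<longlonglongrightarrow> (\<Sum>i<N. 0)"
    using orbit_entropy_tendsto_rate[OF F' A] zero by (intro tendsto_sum) auto
  then have "eventually (\<lambda>n. (\<Sum>i<N. orbit_entropy (A i) (F n) / real (card (F n))) < \<epsilon> / 2) sequentially"
    using \<epsilon> by (intro order_tendstoD) auto
  then obtain n where n: "(\<Sum>i<N. orbit_entropy (A i) (F n) / real (card (F n))) < \<epsilon> / 2"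
    by (auto simp: eventually_sequentially)
  define \<D> where "\<D> m = (\<Union>i<m. translates (A i) (F n))" for m
  have D: "finite (\<D> m)" "\<D> m \<subseteq> events" for m
    unfolding \<D>_def using F(2) by (auto intro!: finite_translates) (meson A F(1) translates_events subsetD)
  have 1: "family_entropy M (\<D> m) \<le> (\<Sum>i<m. orbit_entropy (A i) (F n))" for m
  proof (induction m)
    case (Suc m)
    have "\<D> (Suc m) = \<D> m \<union> translates (A m) (F n)"
      by (auto simp: \<D>_def less_Suc_eq)
    then have "family_entropy M (\<D> (Suc m)) \<le> family_entropy M (\<D> m) + orbit_entropy (A m) (F n)"
      unfolding orbit_entropy_def using D F A
      by (auto intro!: family_entropy_Un_le finite_translates translates_events)
    with Suc show ?case by simp
  qed (simp add: \<D>_def)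
  have ev: "\<phi> g -` ?R \<in> events" if "g \<in> F n" for g
    using that F R by (intro act_vimage_events) auto
  have det: "determined_by M (insert ?R (A ` {..<N})) ?B"
    unfolding determined_by_def by auto
  have imev: "(\<lambda>g. \<phi> g -` ?R) ` F n \<subseteq> events" using ev by (rule image_subsetI)
  have "orbit_entropy ?B (F n) \<le> family_entropy M ((\<lambda>g. \<phi> g -` ?R) ` F n \<union> \<D> N)"
    unfolding orbit_entropy_def
  proof (rule family_entropy_le_if_determined)
    fix C assume "C \<in> translates ?B (F n)"
    then obtain g where g: "g \<in> F n" "C = \<phi> g -` ?B" by (auto simp: translates_def)
    have "\<phi> g -` B \<in> (\<lambda>g. \<phi> g -` ?R) ` F n \<union> \<D> N" if "B \<in> insert ?R (A ` {..<N})" for B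
      using that g(1) unfolding \<D>_def translates_def by blast
    then show "determined_by M ((\<lambda>g. \<phi> g -` ?R) ` F n \<union> \<D> N) C"
      unfolding g(2) by (rule vimage_determined[OF det])
  next
    show "finite ((\<lambda>g. \<phi> g -` ?R) ` F n \<union> \<D> N)" using F(2) D(1) by (intro finite_UnI finite_imageI)
    show "(\<lambda>g. \<phi> g -` ?R) ` F n \<union> \<D> N \<subseteq> events" using imev D(2) by (intro Un_least)
  qed (intro finite_translates translates_events R(2) F)+
  also have "\<dots> \<le> family_entropy M (\<D> N) + real (card (F n)) * (\<epsilon> / 2)"
  proof (rule family_entropy_Un_image_le)
    fix g assume g: "g \<in> F n"
    have "family_entropy M {\<phi> g -` ?R} \<le> 3 * sqrt (prob (\<phi> g -` ?R))"
      using ev[OF g] by (rule family_entropy_singleton_le_sqrt)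
    also have "prob (\<phi> g -` ?R) = prob ?R"
      using g F R by (intro act_prob) auto
    finally show "family_entropy M {\<phi> g -` ?R} \<le> \<epsilon> / 2" using N by linarith
  qed (intro D F ev; assumption)+
  also have "family_entropy M (\<D> N) \<le> (\<Sum>i<N. orbit_entropy (A i) (F n))" by (rule 1)
  also have "\<dots> \<le> \<epsilon> / 2 * real (card (F n))"
    using n F(4)[of n] by (simp add: sum_divide_distrib[symmetric] divide_less_eq less_imp_le)
  finally have "orbit_entropy ?B (F n) \<le> \<epsilon> * real (card (F n))" by (simp add: algebra_simps)
  then show "\<exists>K. finite K \<and> K \<noteq> {} \<and> K \<subseteq> carrier G \<and> orbit_entropy ?B K \<le> \<epsilon> * real (card K)"
    by (intro exI[of _ "F n"] conjI F)
qed

lemma entropy_rate_empty: "entropy_rate {} = 0"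
proof (rule entropy_rate_eq_0I)
  fix \<epsilon> :: real assume "\<epsilon> > 0"
  have "orbit_entropy {} {\<one>} = 0"
    by (simp add: orbit_entropy_def translates_def family_entropy_singleton)
  with \<open>\<epsilon> > 0\<close> show "\<exists>K. finite K \<and> K \<noteq> {} \<and> K \<subseteq> carrier G \<and> orbit_entropy {} K \<le> \<epsilon> * real (card K)"
    by (intro exI[of _ "{\<one>}"]) auto
qed

lemma pinsker_algebra_sigma_algebra:
  assumes "amenable G"
  shows "sigma_algebra (space M) (pinsker_algebra G \<phi> M)"
  unfolding sigma_algebra_iff2
proof (intro conjI ballI allI impI)
  show "pinsker_algebra G \<phi> M \<subseteq> Pow (space M)" by (simp add: space_UNIV)
  show "{} \<in> pinsker_algebra G \<phi> M"
    by (simp add: pinsker_algebra_iff[OF assms] entropy_rate_empty)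
  fix A assume "A \<in> pinsker_algebra G \<phi> M"
  moreover have "{space M - A, space M - (space M - A)} = {A, space M - A}"
    by (auto simp: space_UNIV)
  ultimately show "space M - A \<in> pinsker_algebra G \<phi> M"
    by (auto simp: pinsker_algebra_def)
next
  fix A :: "nat \<Rightarrow> 'x set" assume "range A \<subseteq> pinsker_algebra G \<phi> M"
  then have "A i \<in> pinsker_algebra G \<phi> M" for i by auto
  then show "(\<Union>i. A i) \<in> pinsker_algebra G \<phi> M"
    using entropy_rate_UN_eq_0[OF assms, of A] by (auto simp: pinsker_algebra_iff[OF assms])
qed

text \<open>Left translation of the index set turns the orbit of \<open>\<phi> k -` A\<close> into the orbit of \<open>A\<close>. As the entropy
  rate is an infimum over all finite sets, it is the same for both.\<close>

lemma pinsker_algebra_vimage: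
  assumes "amenable G" "A \<in> pinsker_algebra G \<phi> M" "k \<in> carrier G"
  shows "\<phi> k -` A \<in> pinsker_algebra G \<phi> M"
proof -
  have A: "A \<in> events" "entropy_rate A = 0"
    using assms(2) by (simp_all add: pinsker_algebra_iff[OF assms(1)])
  have "entropy_rate (\<phi> k -` A) = 0"
  proof (rule entropy_rate_eq_0I)
    fix \<epsilon> :: real assume "\<epsilon> > 0"
    then obtain K where K: "finite K" "K \<noteq> {}" "K \<subseteq> carrier G" "orbit_entropy A K / real (card K) < \<epsilon>"
      using A(2) entropy_rate_lessD[of A \<epsilon>] by auto
    define K' where "K' = (\<lambda>g. inv k \<otimes> g) ` K"
    have inj: "inj_on (\<lambda>g. inv k \<otimes> g) K"
      using K assms(3) by (intro inj_onI) (metis inv_closed Units_eq Units_l_cancel subsetD)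
    have "\<phi> (inv k \<otimes> g) -` (\<phi> k -` A) = \<phi> g -` A" if "g \<in> K" for g
    proof -
      have "\<phi> k (\<phi> (inv k \<otimes> g) x) = \<phi> g x" for x
        using that K assms(3) by (subst act_mult[symmetric]) (auto simp: m_assoc[symmetric] subsetD)
      then show ?thesis by auto
    qed
    then have "translates (\<phi> k -` A) K' = translates A K"
      unfolding translates_def K'_def image_image by (rule image_cong[OF refl])
    moreover have "card K' = card K" using inj by (simp add: K'_def card_image)
    moreover have "K' \<subseteq> carrier G" "finite K'" "K' \<noteq> {}" using K assms(3) by (auto simp: K'_def)
    ultimately show "\<exists>K. finite K \<and> K \<noteq> {} \<and> K \<subseteq> carrier G \<and> orbit_entropy (\<phi> k -` A) K \<le> \<epsilon> * real (card K)"
      using K by (intro exI[of _ K']) (simp add: orbit_entropy_def divide_less_eq card_gt_0_iff)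
  qed
  with A(1) assms show ?thesis
    by (simp add: pinsker_algebra_iff act_vimage_events)
qed

end

section \<open>Extraction of subsequences and small hitting sets\<close>

text \<open>Diagonal extraction makes every row converge, a further subsequence makes the limits of the rows
  converge to \<open>a\<close>, and a last one makes each row close to its limit from the next index on.\<close>

lemma asymptotically_constant_subarray:
  fixes c :: "nat \<Rightarrow> nat \<Rightarrow> real"
  assumes c: "\<And>i j. c i j \<in> {0..1}"
  obtains r :: "nat \<Rightarrow> nat" and a where "strict_mono r" "a \<in> {0..1}"
    "\<And>\<epsilon>. \<epsilon> > 0 \<Longrightarrow> \<exists>m. \<forall>i j. m \<le> i \<longrightarrow> i < j \<longrightarrow> \<bar>c (r i) (r j) - a\<bar> \<le> \<epsilon>"
proof -
  interpret subseqs "\<lambda>n s. convergent (\<lambda>j. c n (s j))"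
  proof
    fix n and s :: "nat \<Rightarrow> nat"
    have "\<forall>j. c n (s j) \<in> {0..1}" using c by blast
    then obtain l r' where "strict_mono r'" "((\<lambda>j. c n (s j)) \<circ> r') \<longlonglongrightarrow> l"
      by (rule seq_compactE[OF compact_imp_seq_compact[OF compact_Icc]])
    then show "\<exists>r'. strict_mono r' \<and> convergent (\<lambda>j. c n ((s \<circ> r') j))"
      by (intro exI[of _ r'] conjI convergentI[of _ l]) (simp_all add: o_def)
  qed
  define b where "b n = lim (\<lambda>j. c n (diagseq j))" for n
  have "convergent (\<lambda>j. c n (diagseq j))" for n
  proof -
    have "convergent (\<lambda>j. c n ((diagseq \<circ> (+) (Suc n)) j))"
    proof (rule diagseq_holds)
      fix r s :: "nat \<Rightarrow> nat" and n assume "strict_mono r" "convergent (\<lambda>j. c n (s j))"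
      then show "convergent (\<lambda>j. c n ((s \<circ> r) j))"
        using convergent_subseq_convergent[of "\<lambda>j. c n (s j)" r] by (simp add: o_def)
    qed
    then have "convergent (\<lambda>j. c n (diagseq (j + Suc n)))" by (simp add: o_def add.commute)
    then show ?thesis by (subst (asm) convergent_ignore_initial_segment)
  qed
  then have b: "(\<lambda>j. c n (diagseq j)) \<longlonglongrightarrow> b n" for n
    unfolding b_def by (simp only: convergent_LIMSEQ_iff)
  have b01: "b n \<in> {0..1}" for n
    by (rule closed_sequentially[OF closed_atLeastAtMost _ b]) (rule c)
  have "\<forall>n. b (diagseq n) \<in> {0..1}" using b01 by blast
  then obtain a t where a: "a \<in> {0..1}" and t: "strict_mono t" "((\<lambda>n. b (diagseq n)) \<circ> t) \<longlonglongrightarrow> a"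
    by (rule seq_compactE[OF compact_imp_seq_compact[OF compact_Icc]])
  define q where "q = diagseq \<circ> t"
  have q: "strict_mono q" unfolding q_def using subseq_diagseq t(1) by (rule strict_mono_o)
  have bq: "(\<lambda>i. b (q i)) \<longlonglongrightarrow> a" using t(2) by (simp add: q_def o_def)
  have cq: "(\<lambda>j. c n (q j)) \<longlonglongrightarrow> b n" for n
    using LIMSEQ_subseq_LIMSEQ[OF b[of n] t(1)] by (simp add: q_def o_def)
  have "\<exists>p :: nat \<Rightarrow> nat. \<forall>n. True \<and> p n < p (Suc n) \<and>
      (\<forall>j\<ge>p (Suc n). \<bar>c (q (p n)) (q j) - b (q (p n))\<bar> < inverse (Suc n))"
  proof (rule dependent_nat_choice)
    fix x n :: nat
    obtain N where "\<forall>j\<ge>N. norm (c (q x) (q j) - b (q x)) < inverse (Suc n)"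
      using LIMSEQ_D[OF cq, of "inverse (Suc n)"] by auto
    then show "\<exists>y. True \<and> x < y \<and> (\<forall>j\<ge>y. \<bar>c (q x) (q j) - b (q x)\<bar> < inverse (Suc n))"
      by (intro exI[of _ "max N (Suc x)"]) auto
  qed simp
  then obtain p where p: "\<And>n. p n < p (Suc n)"
    "\<And>n j. j \<ge> p (Suc n) \<Longrightarrow> \<bar>c (q (p n)) (q j) - b (q (p n))\<bar> < inverse (Suc n)"
    by auto
  have p_mono: "strict_mono p" using p(1) by (simp add: strict_mono_Suc_iff)
  show thesis
  proof (rule that[of "q \<circ> p" a])
    show "strict_mono (q \<circ> p)" using q p_mono by (rule strict_mono_o)
    show "a \<in> {0..1}" by (rule a)
    fix \<epsilon> :: real assume "\<epsilon> > 0"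
    have "(\<lambda>n. b (q (p n))) \<longlonglongrightarrow> a"
      using LIMSEQ_subseq_LIMSEQ[OF bq p_mono] by (simp add: o_def)
    from LIMSEQ_D[OF this, of "\<epsilon> / 2"] obtain m1 where m1: "\<And>i. i \<ge> m1 \<Longrightarrow> \<bar>b (q (p i)) - a\<bar> < \<epsilon> / 2"
      using \<open>\<epsilon> > 0\<close> by auto
    obtain m2 where m2: "inverse (real (Suc m2)) < \<epsilon> / 2"
      using reals_Archimedean[of "\<epsilon> / 2"] \<open>\<epsilon> > 0\<close> by auto
    show "\<exists>m. \<forall>i j. m \<le> i \<longrightarrow> i < j \<longrightarrow> \<bar>c ((q \<circ> p) i) ((q \<circ> p) j) - a\<bar> \<le> \<epsilon>"
    proof (intro exI[of _ "max m1 m2"] allI impI)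
      fix i j assume ij: "max m1 m2 \<le> i" "i < j"
      have "p (Suc i) \<le> p j" using ij p_mono by (simp add: strict_mono_less_eq)
      then have "\<bar>c (q (p i)) (q (p j)) - b (q (p i))\<bar> < inverse (Suc i)" by (rule p(2))
      also have "\<dots> \<le> inverse (Suc m2)" using ij by (intro le_imp_inverse_le) auto
      finally have "\<bar>c (q (p i)) (q (p j)) - b (q (p i))\<bar> < \<epsilon> / 2" using m2 by linarith
      with m1[of i] ij show "\<bar>c ((q \<circ> p) i) ((q \<circ> p) j) - a\<bar> \<le> \<epsilon>" by (simp add: abs_if split: if_splits)
    qed
  qed
qed

text \<open>The greedy bound for covers: a point of \<open>U\<close> chosen at random hits each \<open>N g\<close>
  with probability \<open>L / card U\<close>, so as long as more than \<open>\<theta> * card F\<close> of the sets are not hit, some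
  point hits more than \<open>\<theta> * card F * L / card U\<close> of them. The set \<open>R\<close> is a largest one for which
  the number of sets hit is at least \<open>card R\<close> times this gain.\<close>

lemma small_hitting_set:
  fixes N :: "'g \<Rightarrow> 'r set" and \<theta> :: real
  assumes F: "finite F" and U: "finite U" "\<And>g. g \<in> F \<Longrightarrow> N g \<subseteq> U"
    and card: "\<And>g. g \<in> F \<Longrightarrow> card (N g) = L" and pos: "L > 0" "\<theta> > 0"
  obtains R where "R \<subseteq> U" "\<theta> * real L * real (card R) \<le> real (card U)"
    "real (card {g \<in> F. N g \<inter> R = {}}) \<le> \<theta> * real (card F)"
proof (cases "F = {}")
  case True
  show thesis by (rule that[of "{}"]) (simp_all add: True)
next
  case False
  then have F0: "real (card F) > 0" using F by (simp add: card_gt_0_iff)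
  \<comment> \<open>\<open>ok R\<close> says that the points of \<open>R\<close> have achieved the guaranteed gain on average\<close>
  define hit where "hit R = {g \<in> F. N g \<inter> R \<noteq> {}}" for R
  define ok where "ok R \<longleftrightarrow> R \<subseteq> U \<and>
    \<theta> * real L * real (card F) * real (card R) \<le> real (card U) * real (card (hit R))" for R
  have "ok {}" by (simp add: ok_def hit_def)
  moreover have "\<forall>R. ok R \<longrightarrow> card R < Suc (card U)"
    using U by (auto simp: ok_def less_Suc_eq_le intro: card_mono)
  ultimately obtain R where R: "ok R" "\<And>R'. ok R' \<Longrightarrow> card R' \<le> card R"
    using ex_has_greatest_nat[of ok "{}" card "Suc (card U)"] by auto
  have finR: "finite R" using R(1) U finite_subset by (auto simp: ok_def)
  have "real (card (hit R)) \<le> real (card F)"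
    using F by (auto simp: hit_def intro!: card_mono)
  then have "\<theta> * real L * real (card F) * real (card R) \<le> real (card U) * real (card F)"
    using R(1) unfolding ok_def by (meson mult_left_mono of_nat_0_le_iff order_trans)
  then have "(\<theta> * real L * real (card R)) * real (card F) \<le> real (card U) * real (card F)"
    by (simp add: algebra_simps)
  then have 1: "\<theta> * real L * real (card R) \<le> real (card U)"
    using F0 by (simp only: mult_le_cancel_right_pos)
  define W where "W = {g \<in> F. N g \<inter> R = {}}"
  have 2: "real (card W) \<le> \<theta> * real (card F)"
  proof (rule ccontr)
    assume "\<not> ?thesis"
    then have W: "\<theta> * real (card F) < real (card W)" by simp
    have finW: "finite W" using F by (simp add: W_def)
    have "(\<Sum>r\<in>U. real (card {g \<in> W. r \<in> N g})) = (\<Sum>r\<in>U. \<Sum>g\<in>W. of_bool (r \<in> N g))"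
      using finW by (simp add: of_bool_def sum.If_cases Int_def)
    also have "\<dots> = (\<Sum>g\<in>W. \<Sum>r\<in>U. of_bool (r \<in> N g))"
      by (rule sum.swap)
    also have "\<dots> = (\<Sum>g\<in>W. real L)"
    proof (rule sum.cong[OF refl])
      fix g assume "g \<in> W"
      then have g: "g \<in> F" by (simp add: W_def)
      have "{r \<in> U. r \<in> N g} = N g" using U(2)[OF g] by auto
      then show "(\<Sum>r\<in>U. of_bool (r \<in> N g)) = real L"
        using card[OF g] U(1) by (simp add: of_bool_def sum.If_cases Int_def)
    qed
    finally have total: "(\<Sum>r\<in>U. real (card {g \<in> W. r \<in> N g})) = real L * real (card W)" by simp
    have "\<exists>r\<in>U. real (card U) * real (card {g \<in> W. r \<in> N g}) \<ge> real L * real (card W)"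
    proof (rule ccontr)
      assume "\<not> ?thesis"
      then have *: "real (card U) * real (card {g \<in> W. r \<in> N g}) < real L * real (card W)" if "r \<in> U" for r
        using that by (simp add: not_le)
      have "U \<noteq> {}"
      proof
        assume "U = {}"
        with total pos(1) have "card W = 0" by simp
        moreover have "0 \<le> \<theta> * real (card F)" using pos by simp
        ultimately show False using W by simp
      qed
      then have "(\<Sum>r\<in>U. real (card U) * real (card {g \<in> W. r \<in> N g})) < (\<Sum>r\<in>U. real L * real (card W))"
        using * U by (intro sum_strict_mono) auto
      then show False by (simp add: sum_distrib_left[symmetric] total)
    qed
    then obtain r where r: "r \<in> U" "real (card U) * real (card {g \<in> W. r \<in> N g}) \<ge> real L * real (card W)"
      by blast
    have gain: "\<theta> * real L * real (card F) < real (card U) * real (card {g \<in> W. r \<in> N g})"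
    proof -
      have "real L * (\<theta> * real (card F)) < real L * real (card W)"
        using W pos by (intro mult_strict_left_mono) auto
      with r(2) show ?thesis by (simp add: algebra_simps)
    qed
    have "0 \<le> \<theta> * real L * real (card F)" using pos by simp
    with gain have "card {g \<in> W. r \<in> N g} \<noteq> 0" by (intro notI) simp
    then obtain g where "g \<in> W" "r \<in> N g" by (auto simp: card_eq_0_iff)
    then have rR: "r \<notin> R" by (auto simp: W_def)
    have "hit (insert r R) = hit R \<union> {g \<in> W. r \<in> N g}"
      by (auto simp: hit_def W_def)
    moreover have "hit R \<inter> {g \<in> W. r \<in> N g} = {}" by (auto simp: hit_def W_def)
    ultimately have "card (hit (insert r R)) = card (hit R) + card {g \<in> W. r \<in> N g}"
      using F finW by (simp add: card_Un_disjoint hit_def)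
    then have "ok (insert r R)"
      using R(1) r(1) gain finR rR by (simp add: ok_def algebra_simps)
    from R(2)[OF this] finR rR show False by simp
  qed
  show thesis
    using that[of R] R(1) 1 2 by (simp add: ok_def W_def)
qed

section \<open>Inner products and frequencies in the space of square-integrable functions\<close>

lemma integrable_mult_L2:
  assumes "f \<in> L2 M" "g \<in> L2 M"
  shows "integrable M (\<lambda>x. f x * g x)"
proof (rule Bochner_Integration.integrable_bound)
  show "integrable M (\<lambda>x. (f x)\<^sup>2 + (g x)\<^sup>2)"
    using assms by (auto simp: L2_def)
  show "(\<lambda>x. f x * g x) \<in> borel_measurable M"
    using assms by (auto simp: L2_def)
  have "\<bar>a * b\<bar> \<le> a\<^sup>2 + b\<^sup>2" for a b :: real
  proof -
    have "2 * (\<bar>a\<bar> * \<bar>b\<bar>) \<le> a\<^sup>2 + b\<^sup>2" using sum_squares_bound[of "\<bar>a\<bar>" "\<bar>b\<bar>"] by simp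
    moreover have "0 \<le> \<bar>a\<bar> * \<bar>b\<bar>" by simp
    ultimately show ?thesis unfolding abs_mult by linarith
  qed
  then show "AE x in M. norm (f x * g x) \<le> norm ((f x)\<^sup>2 + (g x)\<^sup>2)"
    by (intro AE_I2) (simp add: abs_of_nonneg)
qed

lemma L2_add:
  assumes "f \<in> L2 M" "g \<in> L2 M"
  shows "(\<lambda>x. f x + g x) \<in> L2 M"
proof -
  have "integrable M (\<lambda>x. (f x)\<^sup>2 + (g x)\<^sup>2 + 2 * (f x * g x))"
    using assms integrable_mult_L2[OF assms] by (auto simp: L2_def)
  then have "integrable M (\<lambda>x. (f x + g x)\<^sup>2)"
    by (simp add: power2_sum mult.assoc)
  then show ?thesis using assms by (auto simp: L2_def)
qed

lemma L2_cmult: "f \<in> L2 M \<Longrightarrow> (\<lambda>x. c * f x) \<in> L2 M"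
  by (auto simp: L2_def power_mult_distrib)

lemma L2_diff:
  assumes "f \<in> L2 M" "g \<in> L2 M"
  shows "(\<lambda>x. f x - g x) \<in> L2 M"
  using L2_add[OF assms(1) L2_cmult[OF assms(2), of "-1"]] by simp

text \<open>The quadratic polynomial \<open>\<integral>x. (t * f x + g x)\<^sup>2\<close> in \<open>t\<close> is nonnegative.\<close>

lemma L2_Cauchy_Schwarz:
  assumes f: "f \<in> L2 M" and g: "g \<in> L2 M"
  shows "\<bar>\<integral>x. f x * g x \<partial>M\<bar> \<le> L2_norm M f * L2_norm M g"
proof -
  define A B I where "A = (\<integral>x. (f x)\<^sup>2 \<partial>M)" and "B = (\<integral>x. (g x)\<^sup>2 \<partial>M)" and "I = (\<integral>x. f x * g x \<partial>M)"
  have quad: "0 \<le> A * t\<^sup>2 + 2 * I * t + B" for t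
  proof -
    have "0 \<le> (\<integral>x. (t * f x + g x)\<^sup>2 \<partial>M)" by (rule Bochner_Integration.integral_nonneg) simp
    also have "\<dots> = (\<integral>x. t\<^sup>2 * (f x)\<^sup>2 + (2 * t) * (f x * g x) + (g x)\<^sup>2 \<partial>M)"
      by (intro Bochner_Integration.integral_cong) (auto simp: power2_sum power_mult_distrib)
    also have "\<dots> = t\<^sup>2 * A + (2 * t) * I + B"
      unfolding A_def B_def I_def using f g integrable_mult_L2[OF f g]
      by (subst Bochner_Integration.integral_add, auto simp: L2_def)+
    finally show ?thesis by (simp add: algebra_simps)
  qed
  have nonneg: "0 \<le> A" "0 \<le> B" by (auto simp: A_def B_def)
  have "I\<^sup>2 \<le> A * B"
  proof (cases "A = 0")
    case True
    have "I = 0"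
    proof (rule ccontr)
      assume "I \<noteq> 0"
      then show False using quad[of "- (B + 1) / (2 * I)"] True by simp
    qed
    with True show ?thesis by simp
  next
    case False
    then have "A > 0" using nonneg by simp
    have "A * (- I / A)\<^sup>2 = I\<^sup>2 / A" "2 * I * (- I / A) = - 2 * (I\<^sup>2 / A)"
      using \<open>A > 0\<close> by (simp_all add: power2_eq_square)
    with quad[of "- I / A"] have "I\<^sup>2 / A \<le> B" by linarith
    then show ?thesis using \<open>A > 0\<close> by (simp add: divide_le_eq mult.commute)
  qed
  then have "sqrt (I\<^sup>2) \<le> sqrt (A * B)" by (rule real_sqrt_le_mono)
  then show ?thesis by (simp add: real_sqrt_mult L2_norm_def A_def B_def I_def)
qed

definition frequency :: "('i \<Rightarrow> 'a set) \<Rightarrow> 'i set \<Rightarrow> 'a \<Rightarrow> real" where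
  "frequency E S x = (\<Sum>i\<in>S. indicator (E i) x) / real (card S)"

lemma frequency_bounds: "0 \<le> frequency E S x" "frequency E S x \<le> 1"
proof -
  show "0 \<le> frequency E S x" by (simp add: frequency_def sum_nonneg)
  have "(\<Sum>i\<in>S. indicator (E i) x) \<le> (\<Sum>i\<in>S. 1 :: real)"
    by (intro sum_mono) (simp add: indicator_def)
  then show "frequency E S x \<le> 1"
    by (cases "card S = 0") (simp_all add: frequency_def divide_le_eq_1)
qed

lemma frequency_measurable:
  assumes "\<And>i. i \<in> S \<Longrightarrow> E i \<in> sets M"
  shows "frequency E S \<in> borel_measurable M"
  unfolding frequency_def[abs_def] using assms by (intro borel_measurable_divide borel_measurable_sum) auto

context prob_space
begin

lemma bounded_in_L2:
  assumes "f \<in> borel_measurable M" "\<And>x. \<bar>f x\<bar> \<le> c"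
  shows "f \<in> L2 M"
proof -
  have "(f x)\<^sup>2 \<le> c\<^sup>2" for x using assms(2)[of x] by (simp add: abs_le_square_iff[symmetric])
  then have "integrable M (\<lambda>x. (f x)\<^sup>2)"
    using assms by (intro integrable_const_bound[where B = "c\<^sup>2"]) auto
  then show ?thesis using assms by (simp add: L2_def)
qed

lemma L2_integrable: "f \<in> L2 M \<Longrightarrow> integrable M f"
  using integrable_mult_L2[of f M "\<lambda>_. 1"] by (simp add: L2_def)

lemma frequency_L2: "(\<And>i. i \<in> S \<Longrightarrow> E i \<in> events) \<Longrightarrow> frequency E S \<in> L2 M"
  using frequency_bounds[of E S] by (intro bounded_in_L2[where c = 1] frequency_measurable) (auto simp: abs_le_iff intro: order_trans[of _ 0])

lemma integral_frequency_mult: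
  assumes E: "\<And>i. i \<in> S \<union> T \<Longrightarrow> E i \<in> events"
  shows "(\<integral>x. frequency E S x * frequency E T x \<partial>M) =
    (\<Sum>i\<in>S. \<Sum>j\<in>T. prob (E i \<inter> E j)) / (real (card S) * real (card T))"
proof -
  have prod: "frequency E S x * frequency E T x =
      (\<Sum>i\<in>S. \<Sum>j\<in>T. indicator (E i \<inter> E j) x) / (real (card S) * real (card T))" for x
    by (simp add: frequency_def sum_product indicator_inter_arith)
  have int: "integrable M (indicator (E i \<inter> E j) :: 'a \<Rightarrow> real)" if "i \<in> S" "j \<in> T" for i j
    using E[of i] E[of j] that by (intro integrable_real_indicator) (auto simp: emeasure_eq_measure)
  have "(\<integral>x. (\<Sum>i\<in>S. \<Sum>j\<in>T. indicator (E i \<inter> E j) x) \<partial>M :: real) = (\<Sum>i\<in>S. \<Sum>j\<in>T. prob (E i \<inter> E j))"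
  proof -
    have "(\<integral>x. (\<Sum>i\<in>S. \<Sum>j\<in>T. indicator (E i \<inter> E j) x) \<partial>M :: real)
        = (\<Sum>i\<in>S. \<Sum>j\<in>T. \<integral>x. indicator (E i \<inter> E j) x \<partial>M)"
      by (subst Bochner_Integration.integral_sum; (intro sum.cong refl Bochner_Integration.integral_sum Bochner_Integration.integrable_sum int)?; assumption)
    also have "\<dots> = (\<Sum>i\<in>S. \<Sum>j\<in>T. prob (E i \<inter> E j))"
      using E by (intro sum.cong refl) (simp add: sets.sets_into_space Int_absorb2)
    finally show ?thesis .
  qed
  then show ?thesis unfolding prod by simp
qed

text \<open>The inner product is the mean of \<open>prob (E i \<inter> E j)\<close> over \<open>S \<times> T\<close>. The diagonal pairs are not controlled
  by \<open>\<epsilon>\<close>, but their proportion is at most \<open>1 / card T\<close>.\<close>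

lemma frequency_inner_close:
  assumes E: "\<And>i. i \<in> S \<union> T \<Longrightarrow> E i \<in> events" and a: "a \<in> {0..1}" and \<epsilon>: "0 \<le> \<epsilon>"
    and close: "\<And>i j. i \<in> S \<Longrightarrow> j \<in> T \<Longrightarrow> i \<noteq> j \<Longrightarrow> \<bar>prob (E i \<inter> E j) - a\<bar> \<le> \<epsilon>"
    and fin: "finite S" "S \<noteq> {}" "finite T" "T \<noteq> {}"
  shows "\<bar>(\<integral>x. frequency E S x * frequency E T x \<partial>M) - a\<bar> \<le> \<epsilon> + 1 / real (card T)"
proof -
  have c: "real (card S) > 0" "real (card T) > 0" using fin by (auto simp: card_gt_0_iff)
  have "\<bar>\<Sum>i\<in>S. \<Sum>j\<in>T. prob (E i \<inter> E j) - a\<bar> \<le> (\<Sum>i\<in>S. \<Sum>j\<in>T. \<bar>prob (E i \<inter> E j) - a\<bar>)"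
    by (intro order_trans[OF sum_abs] sum_mono order_refl)
  also have "\<dots> \<le> (\<Sum>i\<in>S. \<Sum>j\<in>T. \<epsilon> + of_bool (i = j))"
  proof (intro sum_mono)
    fix i j assume ij: "i \<in> S" "j \<in> T"
    have "\<bar>prob (E i \<inter> E j) - a\<bar> \<le> 1"
      using a prob_le_1[of "E i \<inter> E j"] measure_nonneg[of M "E i \<inter> E j"] unfolding atLeastAtMost_iff by linarith
    with close[OF ij] \<epsilon> show "\<bar>prob (E i \<inter> E j) - a\<bar> \<le> \<epsilon> + of_bool (i = j)" by (cases "i = j") auto
  qed
  also have "\<dots> \<le> (\<Sum>i\<in>S. real (card T) * \<epsilon> + 1)"
  proof (rule sum_mono)
    fix i
    have "(\<Sum>j\<in>T. of_bool (i = j) :: real) \<le> 1"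
      using fin by (simp add: of_bool_def)
    then show "(\<Sum>j\<in>T. \<epsilon> + of_bool (i = j)) \<le> real (card T) * \<epsilon> + 1" by (simp add: sum.distrib)
  qed
  finally have 1: "\<bar>(\<Sum>i\<in>S. \<Sum>j\<in>T. prob (E i \<inter> E j)) - real (card S) * real (card T) * a\<bar>
      \<le> real (card S) * (real (card T) * \<epsilon> + 1)"
    by (simp add: sum_subtractf)
  have "(\<integral>x. frequency E S x * frequency E T x \<partial>M) - a =
     ((\<Sum>i\<in>S. \<Sum>j\<in>T. prob (E i \<inter> E j)) - real (card S) * real (card T) * a) / (real (card S) * real (card T))"
    using c by (subst integral_frequency_mult[OF E]) (auto simp: field_simps)
  then have "\<bar>(\<integral>x. frequency E S x * frequency E T x \<partial>M) - a\<bar>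
     = \<bar>(\<Sum>i\<in>S. \<Sum>j\<in>T. prob (E i \<inter> E j)) - real (card S) * real (card T) * a\<bar> / (real (card S) * real (card T))"
    using c by simp
  also have "\<dots> \<le> real (card S) * (real (card T) * \<epsilon> + 1) / (real (card S) * real (card T))"
    using 1 c by (intro divide_right_mono) auto
  also have "\<dots> = \<epsilon> + 1 / real (card T)"
    using c by (simp add: field_simps)
  finally show ?thesis .
qed

lemma frequency_L2_close:
  assumes E: "\<And>i. E i \<in> events" and a: "a \<in> {0..1}" and \<epsilon>: "0 \<le> \<epsilon>"
    and close: "\<And>i j. i \<in> S \<union> T \<Longrightarrow> j \<in> S \<union> T \<Longrightarrow> i \<noteq> j \<Longrightarrow> \<bar>prob (E i \<inter> E j) - a\<bar> \<le> \<epsilon>"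
    and fin: "finite S" "S \<noteq> {}" "finite T" "T \<noteq> {}"
  shows "(\<integral>x. (frequency E S x - frequency E T x)\<^sup>2 \<partial>M) \<le> 4 * \<epsilon> + 1 / real (card S) + 3 / real (card T)"
proof -
  let ?f = "frequency E S" and ?g = "frequency E T"
  have L: "?f \<in> L2 M" "?g \<in> L2 M" using E by (auto intro!: frequency_L2)
  note int = integrable_mult_L2[OF L(1) L(1)] integrable_mult_L2[OF L(1) L(2)] integrable_mult_L2[OF L(2) L(2)]
  have "(\<integral>x. (?f x - ?g x)\<^sup>2 \<partial>M) = (\<integral>x. ?f x * ?f x + ?g x * ?g x - 2 * (?f x * ?g x) \<partial>M)"
    by (intro Bochner_Integration.integral_cong) (auto simp: power2_eq_square algebra_simps)
  also have "\<dots> = (\<integral>x. ?f x * ?f x \<partial>M) + (\<integral>x. ?g x * ?g x \<partial>M) - 2 * (\<integral>x. ?f x * ?g x \<partial>M)"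
    using int by simp
  finally have eq: "(\<integral>x. (?f x - ?g x)\<^sup>2 \<partial>M) = \<dots>" .
  have "\<bar>(\<integral>x. ?f x * ?f x \<partial>M) - a\<bar> \<le> \<epsilon> + 1 / real (card S)"
    by (rule frequency_inner_close) (use E a \<epsilon> close fin in auto)
  moreover have "\<bar>(\<integral>x. ?g x * ?g x \<partial>M) - a\<bar> \<le> \<epsilon> + 1 / real (card T)"
    by (rule frequency_inner_close) (use E a \<epsilon> close fin in auto)
  moreover have "\<bar>(\<integral>x. ?f x * ?g x \<partial>M) - a\<bar> \<le> \<epsilon> + 1 / real (card T)"
    by (rule frequency_inner_close) (use E a \<epsilon> close fin in auto)
  moreover have "3 / real (card T) = 3 * (1 / real (card T))" by simp
  ultimately show ?thesis unfolding eq by argo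
qed

end

context prob_space
begin

text \<open>By \<open>frequency_L2_close\<close>, frequencies over large sets of large indices are mutually close in norm. A
  limit \<open>u\<close> of one particular sequence of such frequencies therefore serves for all of them; completeness is
  used in the form that a Cauchy sequence in mean has an almost everywhere convergent subsequence.\<close>

lemma frequency_L2_limit:
  fixes E :: "nat \<Rightarrow> 'a set"
  assumes E: "\<And>i. E i \<in> events" and a: "a \<in> {0..1}"
    and close: "\<And>\<epsilon>. \<epsilon> > 0 \<Longrightarrow> \<exists>m. \<forall>i j. m \<le> i \<longrightarrow> i < j \<longrightarrow> \<bar>prob (E i \<inter> E j) - a\<bar> \<le> \<epsilon>"
  obtains u where "u \<in> borel_measurable M" "\<And>x. u x \<in> {0..1}"
    "\<And>\<epsilon>. \<epsilon> > 0 \<Longrightarrow> \<exists>m n. \<forall>S. finite S \<longrightarrow> S \<subseteq> {m..} \<longrightarrow> n \<le> card S \<longrightarrow>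
        (\<integral>x. (frequency E S x - u x)\<^sup>2 \<partial>M) \<le> \<epsilon>"
proof -
  \<comment> \<open>index sets that move to infinity and grow at the same time\<close>
  define w where "w k = frequency E {k..2 * k}" for k
  have w_meas [measurable]: "w k \<in> borel_measurable M" for k
    unfolding w_def using E by (intro frequency_measurable)
  have w_bounds: "0 \<le> w k x" "w k x \<le> 1" for k x
    unfolding w_def by (rule frequency_bounds)+
  have freq_close: "\<exists>m. \<forall>S T. finite S \<longrightarrow> S \<noteq> {} \<longrightarrow> S \<subseteq> {m..} \<longrightarrow> finite T \<longrightarrow> T \<noteq> {} \<longrightarrow> T \<subseteq> {m..} \<longrightarrow>
      (\<integral>x. (frequency E S x - frequency E T x)\<^sup>2 \<partial>M) \<le> 4 * \<epsilon> + 1 / real (card S) + 3 / real (card T)"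
    if \<epsilon>: "\<epsilon> > 0" for \<epsilon>
  proof -
    obtain m where m: "\<And>i j. m \<le> i \<Longrightarrow> i < j \<Longrightarrow> \<bar>prob (E i \<inter> E j) - a\<bar> \<le> \<epsilon>"
      using close[OF \<epsilon>] by blast
    have m': "\<bar>prob (E i \<inter> E j) - a\<bar> \<le> \<epsilon>" if "m \<le> i" "m \<le> j" "i \<noteq> j" for i j
    proof (cases "i < j")
      case False
      with that have "\<bar>prob (E j \<inter> E i) - a\<bar> \<le> \<epsilon>" by (intro m) auto
      then show ?thesis by (simp add: Int_commute)
    qed (rule m[OF that(1)])
    show ?thesis
    proof (intro exI[of _ m] allI impI)
      fix S T assume "finite S" "S \<noteq> {}" "S \<subseteq> {m..}" "finite T" "T \<noteq> {}" "T \<subseteq> {m..}"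
      moreover from this have "\<bar>prob (E i \<inter> E j) - a\<bar> \<le> \<epsilon>" if "i \<in> S \<union> T" "j \<in> S \<union> T" "i \<noteq> j" for i j
        using that by (intro m') auto
      ultimately show "(\<integral>x. (frequency E S x - frequency E T x)\<^sup>2 \<partial>M) \<le> 4 * \<epsilon> + 1 / real (card S) + 3 / real (card T)"
        using E a \<epsilon> by (intro frequency_L2_close) auto
    qed
  qed
  have w_int: "integrable M (w k)" for k
    using w_bounds[of k] by (intro integrable_const_bound[where B = 1]) auto
  have L1: "(\<integral>x. norm (w i x - w j x) \<partial>M) \<le> sqrt (\<integral>x. (w i x - w j x)\<^sup>2 \<partial>M)" for i j
  proof -
    have d: "\<bar>w i x - w j x\<bar> \<le> 1" for x using w_bounds[of i x] w_bounds[of j x] by linarith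
    have "\<bar>\<integral>x. \<bar>w i x - w j x\<bar> * 1 \<partial>M\<bar> \<le> L2_norm M (\<lambda>x. \<bar>w i x - w j x\<bar>) * L2_norm M (\<lambda>x. 1)"
      using d by (intro L2_Cauchy_Schwarz bounded_in_L2[where c = 1]) auto
    then show ?thesis by (simp add: L2_norm_def prob_space)
  qed
  have "\<exists>N. \<forall>i\<ge>N. \<forall>j\<ge>N. (\<integral>x. norm (w i x - w j x) \<partial>M) < e" if e: "e > 0" for e
  proof -
    have "e\<^sup>2 / 16 > 0" using e by simp
    from freq_close[OF this] obtain m where m: "\<And>S T. finite S \<Longrightarrow> S \<noteq> {} \<Longrightarrow> S \<subseteq> {m..} \<Longrightarrow> finite T \<Longrightarrow> T \<noteq> {} \<Longrightarrow> T \<subseteq> {m..} \<Longrightarrow>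
      (\<integral>x. (frequency E S x - frequency E T x)\<^sup>2 \<partial>M) \<le> 4 * (e\<^sup>2 / 16) + 1 / real (card S) + 3 / real (card T)"
      by blast
    obtain N where N: "1 / real (Suc N) < e\<^sup>2 / 8" using e nat_approx_posE[of "e\<^sup>2 / 8"] by auto
    show ?thesis
    proof (intro exI[of _ "max m N"] allI impI)
      fix i j assume ij: "max m N \<le> i" "max m N \<le> j"
      have "(\<integral>x. (w i x - w j x)\<^sup>2 \<partial>M) \<le> 4 * (e\<^sup>2 / 16) + 1 / real (card {i..2 * i}) + 3 / real (card {j..2 * j})"
        unfolding w_def using ij by (intro m) auto
      also have "\<dots> = e\<^sup>2 / 4 + 1 / real (Suc i) + 3 * (1 / real (Suc j))" by simp
      also have "1 / real (Suc i) \<le> 1 / real (Suc N)" using ij by (intro divide_left_mono) auto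
      also have "1 / real (Suc j) \<le> 1 / real (Suc N)" using ij by (intro divide_left_mono) auto
      finally have "(\<integral>x. (w i x - w j x)\<^sup>2 \<partial>M) < e\<^sup>2" using N zero_less_power[OF e, of 2] by linarith
      then have "sqrt (\<integral>x. (w i x - w j x)\<^sup>2 \<partial>M) < e" using e by (simp add: real_less_lsqrt)
      with L1[of i j] show "(\<integral>x. norm (w i x - w j x) \<partial>M) < e" by linarith
    qed
  qed
  with w_int obtain r where r: "strict_mono r" "AE x in M. Cauchy (\<lambda>i. w (r i) x)"
    by (rule cauchy_L1_AE_cauchy_subseq)
  \<comment> \<open>truncation only affects the null set where the sequence does not converge\<close>
  define u where "u x = max 0 (min 1 (lim (\<lambda>i. w (r i) x)))" for x
  have u_meas [measurable]: "u \<in> borel_measurable M"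
    unfolding u_def[abs_def] by (intro borel_measurable_max borel_measurable_min borel_measurable_lim_metric borel_measurable_const w_meas)
  have u_bounds: "0 \<le> u x" "u x \<le> 1" for x by (auto simp: u_def)
  have lim: "AE x in M. (\<lambda>i. w (r i) x) \<longlonglongrightarrow> u x"
    using r(2)
  proof eventually_elim
    case (elim x)
    then have l: "(\<lambda>i. w (r i) x) \<longlonglongrightarrow> lim (\<lambda>i. w (r i) x)"
      by (simp add: Cauchy_convergent_iff convergent_LIMSEQ_iff)
    moreover have "0 \<le> lim (\<lambda>i. w (r i) x)" by (rule LIMSEQ_le_const[OF l]) (use w_bounds in auto)
    moreover have "lim (\<lambda>i. w (r i) x) \<le> 1" by (rule LIMSEQ_le_const2[OF l]) (use w_bounds in auto)
    ultimately show ?case by (simp add: u_def)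
  qed
  have "\<exists>m n. \<forall>S. finite S \<longrightarrow> S \<subseteq> {m..} \<longrightarrow> n \<le> card S \<longrightarrow> (\<integral>x. (frequency E S x - u x)\<^sup>2 \<partial>M) \<le> \<epsilon>"
    if \<epsilon>: "\<epsilon> > 0" for \<epsilon>
  proof -
    have "\<epsilon> / 8 > 0" using \<epsilon> by simp
    from freq_close[OF this] obtain m where m: "\<And>S T. finite S \<Longrightarrow> S \<noteq> {} \<Longrightarrow> S \<subseteq> {m..} \<Longrightarrow> finite T \<Longrightarrow> T \<noteq> {} \<Longrightarrow> T \<subseteq> {m..} \<Longrightarrow>
      (\<integral>x. (frequency E S x - frequency E T x)\<^sup>2 \<partial>M) \<le> 4 * (\<epsilon> / 8) + 1 / real (card S) + 3 / real (card T)"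
      by blast
    obtain N where N: "1 / real (Suc N) < \<epsilon> / 2" using \<epsilon> nat_approx_posE[of "\<epsilon> / 2"] by auto
    show ?thesis
    proof (rule exI[of _ m], rule exI[of _ "Suc N"], intro allI impI)
      fix S assume S: "finite S" "S \<subseteq> {m..}" "Suc N \<le> card S"
      let ?f = "frequency E S"
      have f_meas: "?f \<in> borel_measurable M" using E by (intro frequency_measurable)
      have "(\<lambda>k. \<integral>x. (?f x - w (r k) x)\<^sup>2 \<partial>M) \<longlonglongrightarrow> (\<integral>x. (?f x - u x)\<^sup>2 \<partial>M)"
      proof (rule integral_dominated_convergence[where w = "\<lambda>_. 1"])
        show "(\<lambda>x. (?f x - u x)\<^sup>2) \<in> borel_measurable M" "\<And>k. (\<lambda>x. (?f x - w (r k) x)\<^sup>2) \<in> borel_measurable M"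
          using f_meas by measurable
        show "AE x in M. (\<lambda>k. (?f x - w (r k) x)\<^sup>2) \<longlonglongrightarrow> (?f x - u x)\<^sup>2"
          using lim by eventually_elim (intro tendsto_intros)
        have "\<bar>?f x - w (r k) x\<bar> \<le> 1" for x k
          using frequency_bounds[of E S x] w_bounds[of "r k" x] by linarith
        then show "\<And>k. AE x in M. norm ((?f x - w (r k) x)\<^sup>2) \<le> 1"
          by (intro AE_I2) (simp add: abs_square_le_1)
      qed simp
      moreover have "(\<lambda>k. \<epsilon> / 2 + 1 / real (card S) + 3 / real (Suc k)) \<longlonglongrightarrow> \<epsilon> / 2 + 1 / real (card S) + 0"
        by (intro tendsto_intros tendsto_divide_0[OF tendsto_const] filterlim_compose[OF filterlim_real_sequentially] filterlim_Suc filterlim_at_top_imp_at_infinity)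
      ultimately have "(\<integral>x. (?f x - u x)\<^sup>2 \<partial>M) \<le> \<epsilon> / 2 + 1 / real (card S) + 0"
      proof (rule LIMSEQ_le)
        show "\<exists>K. \<forall>k\<ge>K. (\<integral>x. (?f x - w (r k) x)\<^sup>2 \<partial>M) \<le> \<epsilon> / 2 + 1 / real (card S) + 3 / real (Suc k)"
        proof (intro exI[of _ m] allI impI)
          fix k assume k: "m \<le> k"
          have rk: "k \<le> r k" using r(1) by (rule seq_suble)
          have "(\<integral>x. (?f x - w (r k) x)\<^sup>2 \<partial>M) \<le> 4 * (\<epsilon> / 8) + 1 / real (card S) + 3 / real (card {r k..2 * r k})"
            unfolding w_def using S k rk by (intro m) auto
          also have "3 / real (card {r k..2 * r k}) \<le> 3 / real (Suc k)"
            using rk by (intro divide_left_mono) auto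
          finally show "(\<integral>x. (?f x - w (r k) x)\<^sup>2 \<partial>M) \<le> \<epsilon> / 2 + 1 / real (card S) + 3 / real (Suc k)" by simp
        qed
      qed
      also have "1 / real (card S) \<le> 1 / real (Suc N)"
        using S(3) by (intro divide_left_mono) auto
      finally show "(\<integral>x. (?f x - u x)\<^sup>2 \<partial>M) \<le> \<epsilon>" using N by linarith
    qed
  qed
  then show thesis using u_meas u_bounds by (intro that[of u]) auto
qed

lemma frequency_determined: "determined_by M (E ` S) {x \<in> space M. t < frequency E S x}"
  unfolding determined_by_def
proof (intro ballI impI)
  fix x y assume xy: "x \<in> space M" "y \<in> space M" "\<forall>C\<in>E ` S. x \<in> C \<longleftrightarrow> y \<in> C"
  have "indicator (E i) x = (indicator (E i) y :: real)" if "i \<in> S" for i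
    using bspec[OF xy(3) imageI[OF that]] by (simp only: indicator_def)
  then have "frequency E S x = frequency E S y"
    by (simp add: frequency_def)
  with xy(1,2) show "x \<in> {x \<in> space M. t < frequency E S x} \<longleftrightarrow> y \<in> {x \<in> space M. t < frequency E S x}"
    by simp
qed

text \<open>The approximating event is a level set of a frequency at a slightly higher level than \<open>t\<close>. Shifting the
  level matters because \<open>u\<close> may equal \<open>t\<close> with positive probability: a point with
  \<open>u x \<le> t\<close> is then misplaced only if the frequency is far from \<open>u x\<close>, and for a misplaced point with
  \<open>t < u x\<close> either the same is true or \<open>u x\<close> lies in a short interval to the right of \<open>t\<close>, which
  has small probability.\<close>

lemma level_set_approx:
  fixes E :: "nat \<Rightarrow> 'a set"
  assumes E: "\<And>i. E i \<in> events" and u: "u \<in> borel_measurable M" "\<And>x. u x \<in> {0..1}"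
    and lim: "\<And>\<epsilon>. \<epsilon> > 0 \<Longrightarrow> \<exists>m n. \<forall>S. finite S \<longrightarrow> S \<subseteq> {m..} \<longrightarrow> n \<le> card S \<longrightarrow>
        (\<integral>x. (frequency E S x - u x)\<^sup>2 \<partial>M) \<le> \<epsilon>"
    and \<delta>: "\<delta> > 0"
  shows "\<exists>m n. \<forall>S. finite S \<longrightarrow> S \<subseteq> {m..} \<longrightarrow> n \<le> card S \<longrightarrow>
    (\<exists>B\<in>events. determined_by M (E ` S) B \<and>
       prob (({x \<in> space M. t < u x} - B) \<union> (B - {x \<in> space M. t < u x})) \<le> \<delta>)"
proof -
  note [measurable] = u(1)
  \<comment> \<open>preimages of shrinking intervals to the right of \<open>t\<close>; they decrease to the empty set\<close>
  define gap where "gap n = {x \<in> space M. t < u x \<and> u x \<le> t + 1 / real (Suc n)}" for n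
  have gap_ev: "gap n \<in> events" for n unfolding gap_def by measurable
  have "(\<lambda>n. prob (gap n)) \<longlonglongrightarrow> prob (\<Inter>n. gap n)"
  proof (rule finite_Lim_measure_decseq)
    show "range gap \<subseteq> events" using gap_ev by auto
    show "decseq gap"
    proof (rule decseq_SucI, rule subsetI)
      fix n x assume x: "x \<in> gap (Suc n)"
      have "1 / real (Suc (Suc n)) \<le> 1 / real (Suc n)" by (intro divide_left_mono) auto
      with x show "x \<in> gap n" unfolding gap_def by auto
    qed
  qed
  moreover have "(\<Inter>n. gap n) = {}"
  proof (rule ccontr)
    assume "\<not> ?thesis"
    then obtain x where "\<And>n. x \<in> gap n" by auto
    then have *: "t < u x" "\<And>n. u x - t \<le> 1 / real (Suc n)" by (auto simp: gap_def algebra_simps)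
    then obtain n where "1 / real (Suc n) < u x - t" using nat_approx_posE[of "u x - t"] by auto
    with *(2)[of n] show False by simp
  qed
  ultimately have "(\<lambda>n. prob (gap n)) \<longlonglongrightarrow> 0" by simp
  then have "eventually (\<lambda>n. prob (gap n) < \<delta> / 2) sequentially"
    by (rule order_tendstoD) (use \<delta> in simp)
  then obtain k where k: "prob (gap k) < \<delta> / 2" by (auto simp: eventually_sequentially)
  define \<eta> where "\<eta> = 1 / real (Suc k)"
  have \<eta>: "\<eta> > 0" by (simp add: \<eta>_def)
  have "\<delta> * \<eta>\<^sup>2 / 8 > 0" using \<delta> \<eta> by simp
  from lim[OF this] obtain m n where mn: "\<And>S. finite S \<Longrightarrow> S \<subseteq> {m..} \<Longrightarrow> n \<le> card S \<Longrightarrow>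
        (\<integral>x. (frequency E S x - u x)\<^sup>2 \<partial>M) \<le> \<delta> * \<eta>\<^sup>2 / 8"
    by blast
  show ?thesis
  proof (rule exI[of _ m], rule exI[of _ n], intro allI impI)
    fix S assume S: "finite S" "S \<subseteq> {m..}" "n \<le> card S"
    let ?f = "frequency E S"
    have f [measurable]: "?f \<in> borel_measurable M" using E by (intro frequency_measurable)
    \<comment> \<open>halfway between \<open>t\<close> and \<open>t + \<eta>\<close>\<close>
    define B where "B = {x \<in> space M. t + \<eta> / 2 < ?f x}"
    define far where "far = {x \<in> space M. (\<eta> / 2)\<^sup>2 \<le> (?f x - u x)\<^sup>2}"
    have far_ev: "far \<in> events" unfolding far_def by measurable
    have B_ev: "B \<in> events" unfolding B_def by measurable
    have far_iff: "x \<in> far \<longleftrightarrow> x \<in> space M \<and> \<eta> / 2 \<le> \<bar>?f x - u x\<bar>" for x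
      using \<eta> abs_le_square_iff[of "\<eta> / 2" "?f x - u x"] by (simp add: far_def)
    have "({x \<in> space M. t < u x} - B) \<union> (B - {x \<in> space M. t < u x}) \<subseteq> gap k \<union> far"
    proof
      fix x assume "x \<in> ({x \<in> space M. t < u x} - B) \<union> (B - {x \<in> space M. t < u x})"
      then have x: "x \<in> space M" "(t < u x \<and> ?f x \<le> t + \<eta> / 2) \<or> (u x \<le> t \<and> t + \<eta> / 2 < ?f x)"
        by (auto simp: B_def not_less)
      show "x \<in> gap k \<union> far"
      proof (cases "\<eta> / 2 \<le> \<bar>?f x - u x\<bar>")
        case False
        then have "t < u x" "u x \<le> t + \<eta>" using x(2) by linarith+
        with x(1) show ?thesis by (simp add: gap_def \<eta>_def)
      qed (use x far_iff in simp)
    qed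
    then have "prob (({x \<in> space M. t < u x} - B) \<union> (B - {x \<in> space M. t < u x})) \<le> prob (gap k \<union> far)"
      using gap_ev far_ev by (intro finite_measure_mono) auto
    also have "\<dots> \<le> prob (gap k) + prob far"
      using gap_ev far_ev by (intro measure_Un_le)
    also have "prob far \<le> (\<integral>x. (?f x - u x)\<^sup>2 \<partial>M) / (\<eta> / 2)\<^sup>2"
      unfolding far_def
    proof (rule integral_Markov_inequality_measure[where A = "{}"])
      have "\<bar>?f x - u x\<bar> \<le> 1" for x
        using frequency_bounds[of E S x] u(2)[of x] unfolding atLeastAtMost_iff by linarith
      then have "(\<lambda>x. ?f x - u x) \<in> L2 M" by (intro bounded_in_L2) auto
      then show "integrable M (\<lambda>x. (?f x - u x)\<^sup>2)" by (simp add: L2_def)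
      show "{} \<in> events" by simp
    qed (use \<eta> in auto)
    also have "\<dots> \<le> (\<delta> * \<eta>\<^sup>2 / 8) / (\<eta> / 2)\<^sup>2"
      using mn[OF S] by (intro divide_right_mono) auto
    also have "\<dots> = \<delta> / 2" using \<eta> by (simp add: power_divide)
    finally have "prob (({x \<in> space M. t < u x} - B) \<union> (B - {x \<in> space M. t < u x})) \<le> \<delta>"
      using k by linarith
    then show "\<exists>B\<in>events. determined_by M (E ` S) B \<and>
       prob (({x \<in> space M. t < u x} - B) \<union> (B - {x \<in> space M. t < u x})) \<le> \<delta>"
      using B_ev frequency_determined[of E S "t + \<eta> / 2"] unfolding B_def by blast
  qed
qed

end

section \<open>Limits of far translates have zero entropy\<close>

lemma determined_by_via_difference:
  assumes "determined_by M \<D> B"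
  shows "determined_by M (insert ((C - B) \<union> (B - C)) \<D>) C"
  unfolding determined_by_def
proof (intro ballI impI)
  fix x y assume xy: "x \<in> space M" "y \<in> space M"
    and *: "\<forall>D\<in>insert ((C - B) \<union> (B - C)) \<D>. x \<in> D \<longleftrightarrow> y \<in> D"
  have "x \<in> D \<longleftrightarrow> y \<in> D" if "D \<in> \<D>" for D
    using * that by (rule bspec[OF _ insertI2])
  then have "\<forall>D\<in>\<D>. x \<in> D \<longleftrightarrow> y \<in> D" by (rule ballI)
  with assms xy have "x \<in> B \<longleftrightarrow> y \<in> B" unfolding determined_by_def by metis
  moreover from * have "x \<in> (C - B) \<union> (B - C) \<longleftrightarrow> y \<in> (C - B) \<union> (B - C)" by (rule bspec[OF _ insertI1])
  ultimately show "x \<in> C \<longleftrightarrow> y \<in> C" by blast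
qed

context mp_action
begin

lemma translates_entropy_le:
  assumes "A \<in> events" "F \<subseteq> carrier G" "finite F"
  shows "family_entropy M (translates A F) \<le> 2 * real (card F)"
proof -
  have "family_entropy M ((\<lambda>g. \<phi> g -` A) ` F \<union> {}) \<le> family_entropy M {} + real (card F) * 2"
    using assms by (intro family_entropy_Un_image_le family_entropy_singleton_le_2 act_vimage_events) auto
  then show ?thesis by (simp add: translates_def)
qed

text \<open>Cut the indices from \<open>m\<close> on into \<open>n\<close> long blocks. For a single block, the elements \<open>\<gamma> i \<otimes> g\<close>
  form a large set for every \<open>g\<close>, so by \<open>small_hitting_set\<close> a sparse set meets most of them;
  the union over the blocks contains, for most \<open>g\<close>, one element for each block.\<close>

lemma sparse_set_meeting_far_blocks:
  fixes \<gamma> :: "nat \<Rightarrow> 'g"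
  assumes F: "folner_sequence G F"
    and \<gamma>: "inj \<gamma>" "range \<gamma> \<subseteq> carrier G" and \<epsilon>: "\<epsilon> > 0"
  obtains N R bad where "R \<subseteq> carrier G" "finite R" "bad \<subseteq> F N"
    "real (card R) \<le> \<epsilon> * real (card (F N))" "real (card bad) \<le> \<epsilon> * real (card (F N))"
    "\<And>g. g \<in> F N - bad \<Longrightarrow> \<exists>S. finite S \<and> S \<subseteq> {m..} \<and> card S = n \<and> (\<forall>i\<in>S. \<gamma> i \<otimes> g \<in> R)"
proof -
  \<comment> \<open>the proportion missed for each of the \<open>n\<close> blocks; \<open>Suc n\<close> avoids division by zero\<close>
  define \<theta> where "\<theta> = \<epsilon> / real (Suc n)"
  have \<theta>: "\<theta> > 0" using \<epsilon> by (simp add: \<theta>_def)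
  \<comment> \<open>the \<open>n\<close> hitting sets have at most \<open>2 * card (F N) / (\<theta> * L)\<close> elements each\<close>
  obtain L0 :: nat where L0: "2 * real n / (\<theta> * \<epsilon>) \<le> real L0" using real_arch_simple by blast
  define L where "L = Suc L0"
  have "2 * real n / (\<theta> * \<epsilon>) \<le> real L" using L0 by (simp add: L_def)
  then have L: "L > 0" "2 * real n \<le> real L * (\<theta> * \<epsilon>)"
    using \<theta> \<epsilon> by (simp_all add: L_def divide_le_eq del: of_nat_Suc)
  \<comment> \<open>the indices of the \<open>j\<close>-th block; blocks have length \<open>L\<close>\<close>
  define block where "block j = {m + j * L..<m + Suc j * L}" for j
  have block_disj: "i \<noteq> i'" if "i \<in> block j" "i' \<in> block j'" "j < j'" for i i' j j'
  proof -
    have "Suc j * L \<le> j' * L" using that(3) by (intro mult_le_mono1) simp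
    with that show ?thesis unfolding block_def atLeastLessThan_iff by linarith
  qed
  define K where "K = \<gamma> ` (\<Union>j<n. block j)"
  have K: "finite K" "K \<subseteq> carrier G" using \<gamma>(2) by (auto simp: K_def block_def)
  obtain \<delta> where \<delta>: "\<delta> \<longlonglongrightarrow> (0::real)"
    "\<And>N. real (card (\<Union>k\<in>K. k <# F N)) \<le> (1 + \<delta> N) * real (card (F N))"
    using folner_sequence_product[OF F K] by blast
  have "eventually (\<lambda>N. \<delta> N < 1) sequentially" using \<delta>(1) by (rule order_tendstoD) simp
  then obtain N where N: "\<delta> N < 1" by (auto simp: eventually_sequentially)
  note FN = folner_sequenceD[OF F, of N]
  define U where "U = (\<Union>k\<in>K. k <# F N)"
  have U: "finite U" "U \<subseteq> carrier G" using K FN by (auto simp: U_def l_coset_def)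
  have "real (card U) \<le> (1 + \<delta> N) * real (card (F N))" unfolding U_def by (rule \<delta>(2))
  also have "\<dots> \<le> 2 * real (card (F N))" using N by (intro mult_right_mono) auto
  finally have cardU: "real (card U) \<le> 2 * real (card (F N))" .
  define hits where "hits j R \<longleftrightarrow> R \<subseteq> U \<and> \<theta> * real L * real (card R) \<le> real (card U) \<and>
     real (card {g \<in> F N. (\<lambda>i. \<gamma> i \<otimes> g) ` block j \<inter> R = {}}) \<le> \<theta> * real (card (F N))" for j R
  have "\<forall>j\<in>{..<n}. \<exists>R. hits j R"
  proof
    fix j assume "j \<in> {..<n}"
    then have j: "j < n" by simp
    have inj: "inj_on (\<lambda>i. \<gamma> i \<otimes> g) (block j)" if "g \<in> F N" for g
    proof (rule inj_onI)
      fix i i' assume "\<gamma> i \<otimes> g = \<gamma> i' \<otimes> g"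
      moreover have "\<gamma> i \<in> carrier G" "\<gamma> i' \<in> carrier G" "g \<in> carrier G" using \<gamma>(2) FN that by auto
      ultimately have "\<gamma> i = \<gamma> i'" by simp
      then show "i = i'" by (rule injD[OF \<gamma>(1)])
    qed
    have sub: "(\<lambda>i. \<gamma> i \<otimes> g) ` block j \<subseteq> U" if "g \<in> F N" for g
      using that j by (auto simp: U_def K_def l_coset_def)
    have crd: "card ((\<lambda>i. \<gamma> i \<otimes> g) ` block j) = L" if "g \<in> F N" for g
      using card_image[OF inj[OF that]] by (simp add: block_def)
    obtain R where "R \<subseteq> U" "\<theta> * real L * real (card R) \<le> real (card U)"
      "real (card {g \<in> F N. (\<lambda>i. \<gamma> i \<otimes> g) ` block j \<inter> R = {}}) \<le> \<theta> * real (card (F N))"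
      by (rule small_hitting_set[OF FN(2) U(1) sub crd L(1) \<theta>])
    then show "\<exists>R. hits j R" unfolding hits_def by (intro exI[of _ R] conjI)
  qed
  from bchoice[OF this] obtain R where "\<forall>j\<in>{..<n}. hits j (R j)" by (rule exE)
  then have R: "\<And>j. j < n \<Longrightarrow> R j \<subseteq> U" "\<And>j. j < n \<Longrightarrow> \<theta> * real L * real (card (R j)) \<le> real (card U)"
    "\<And>j. j < n \<Longrightarrow> real (card {g \<in> F N. (\<lambda>i. \<gamma> i \<otimes> g) ` block j \<inter> R j = {}}) \<le> \<theta> * real (card (F N))"
    by (simp_all add: hits_def)
  define RR where "RR = (\<Union>j<n. R j)"
  define miss where "miss j = {g \<in> F N. (\<lambda>i. \<gamma> i \<otimes> g) ` block j \<inter> R j = {}}" for j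
  define bad where "bad = (\<Union>j<n. miss j)"
  have "RR \<subseteq> U" using R(1) by (auto simp: RR_def)
  then have RR: "finite RR" "RR \<subseteq> carrier G" using U finite_subset by auto
  have "card RR \<le> (\<Sum>j<n. card (R j))" unfolding RR_def by (rule card_UN_le) simp
  then have "\<theta> * real L * real (card RR) \<le> \<theta> * real L * (\<Sum>j<n. real (card (R j)))"
    using \<theta> by (intro mult_left_mono) (simp_all flip: of_nat_sum)
  also have "\<dots> = (\<Sum>j<n. \<theta> * real L * real (card (R j)))" by (simp add: sum_distrib_left)
  also have "\<dots> \<le> (\<Sum>j<n. 2 * real (card (F N)))"
    by (intro sum_mono order_trans[OF R(2) cardU]) simp
  also have "\<dots> = 2 * real n * real (card (F N))" by simp
  also have "\<dots> \<le> real L * (\<theta> * \<epsilon>) * real (card (F N))"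
    using L(2) by (intro mult_right_mono) auto
  finally have "\<theta> * real L * real (card RR) \<le> \<theta> * real L * (\<epsilon> * real (card (F N)))"
    by (simp add: algebra_simps)
  moreover have "\<theta> * real L > 0" using \<theta> L by simp
  ultimately have cardRR: "real (card RR) \<le> \<epsilon> * real (card (F N))"
    by (simp only: mult_le_cancel_left_pos)
  have "card bad \<le> (\<Sum>j<n. card (miss j))" unfolding bad_def by (rule card_UN_le) simp
  then have "real (card bad) \<le> (\<Sum>j<n. real (card (miss j)))" by (simp flip: of_nat_sum)
  also have "\<dots> \<le> (\<Sum>j<n. \<theta> * real (card (F N)))"
    using R(3) by (intro sum_mono) (auto simp: miss_def)
  also have "\<dots> = (real n * \<theta>) * real (card (F N))" by simp
  also have "\<dots> \<le> \<epsilon> * real (card (F N))"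
    using \<epsilon> by (intro mult_right_mono) (auto simp: \<theta>_def divide_le_eq)
  finally have cardbad: "real (card bad) \<le> \<epsilon> * real (card (F N))" .
  have good: "\<exists>S. finite S \<and> S \<subseteq> {m..} \<and> card S = n \<and> (\<forall>i\<in>S. \<gamma> i \<otimes> g \<in> RR)" if g: "g \<in> F N - bad" for g
  proof -
    have "\<exists>i\<in>block j. \<gamma> i \<otimes> g \<in> R j" if "j < n" for j
    proof -
      have "g \<notin> miss j" using g that by (auto simp: bad_def)
      then show ?thesis using g by (auto simp: miss_def)
    qed
    then obtain i where i: "\<And>j. j < n \<Longrightarrow> i j \<in> block j" "\<And>j. j < n \<Longrightarrow> \<gamma> (i j) \<otimes> g \<in> R j" by metis
    have "inj_on i {..<n}"
    proof (rule linorder_inj_onI)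
      fix j j' assume "j < j'" "j \<in> {..<n}" "j' \<in> {..<n}"
      then show "i j \<noteq> i j'" using i(1) by (intro block_disj) auto
    qed auto
    then have "card (i ` {..<n}) = n" by (simp add: card_image)
    moreover have "i ` {..<n} \<subseteq> {m..}" using i(1) by (fastforce simp: block_def)
    moreover have "\<forall>k\<in>i ` {..<n}. \<gamma> k \<otimes> g \<in> RR" using i(2) by (auto simp: RR_def)
    ultimately show ?thesis by (intro exI[of _ "i ` {..<n}"]) simp
  qed
  have "bad \<subseteq> F N" by (auto simp: bad_def miss_def)
  with that[of RR bad N] RR cardRR cardbad good show thesis by blast
qed

text \<open>For most \<open>g\<close> in a Folner set the event \<open>\<phi> g -` C\<close> is, up to the small error \<open>X g\<close>, determined by the
  translates of \<open>A\<close> over the sparse set \<open>R\<close> of \<open>sparse_set_meeting_far_blocks\<close>. So the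
  translates of \<open>C\<close> are determined by the translates of \<open>A\<close> over \<open>R\<close>, the translates of \<open>C\<close>
  over the few remaining \<open>g\<close>, and the events \<open>X g\<close>; all three have little entropy.\<close>

lemma entropy_rate_eq_0_if_determined_far_away:
  fixes \<gamma> :: "nat \<Rightarrow> 'g"
  assumes am: "amenable G" and A: "A \<in> events" and C: "C \<in> events"
    and \<gamma>: "inj \<gamma>" "range \<gamma> \<subseteq> carrier G"
    and approx: "\<And>\<delta>. \<delta> > 0 \<Longrightarrow> \<exists>m n. \<forall>S. finite S \<longrightarrow> S \<subseteq> {m..} \<longrightarrow> n \<le> card S \<longrightarrow>
       (\<exists>B\<in>events. determined_by M ((\<lambda>i. \<phi> (\<gamma> i) -` A) ` S) B \<and> prob ((C - B) \<union> (B - C)) \<le> \<delta>)"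
  shows "entropy_rate C = 0"
proof (rule entropy_rate_eq_0I)
  fix \<epsilon> :: real assume "\<epsilon> > 0"
  \<comment> \<open>each of the two exceptional sets costs \<open>2 * e\<close>, the small errors cost \<open>e\<close>\<close>
  define e where "e = \<epsilon> / 5"
  have e: "e > 0" using \<open>\<epsilon> > 0\<close> by (simp add: e_def)
  \<comment> \<open>by \<open>family_entropy_singleton_le_sqrt\<close>, an event of this probability has entropy at most \<open>e\<close>\<close>
  have "(e / 3)\<^sup>2 > 0" using e by simp
  from approx[OF this] obtain m n where mn: "\<And>S. finite S \<Longrightarrow> S \<subseteq> {m..} \<Longrightarrow> n \<le> card S \<Longrightarrow>
       \<exists>B\<in>events. determined_by M ((\<lambda>i. \<phi> (\<gamma> i) -` A) ` S) B \<and> prob ((C - B) \<union> (B - C)) \<le> (e / 3)\<^sup>2"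
    by blast
  obtain F where F': "folner_sequence G F" using am by (auto simp: amenable_def)
  obtain N R bad where R: "R \<subseteq> carrier G" "finite R" and bad: "bad \<subseteq> F N"
    and small: "real (card R) \<le> e * real (card (F N))" "real (card bad) \<le> e * real (card (F N))"
    and good: "\<And>g. g \<in> F N - bad \<Longrightarrow> \<exists>S. finite S \<and> S \<subseteq> {m..} \<and> card S = n \<and> (\<forall>i\<in>S. \<gamma> i \<otimes> g \<in> R)"
    using sparse_set_meeting_far_blocks[OF F' \<gamma> e] by metis
  note F = folner_sequenceD[OF F', of N]
  have "\<exists>B\<in>events. determined_by M (translates A R) (\<phi> g -` B) \<and> prob ((C - B) \<union> (B - C)) \<le> (e / 3)\<^sup>2"
    if g: "g \<in> F N - bad" for g
  proof -
    obtain S where S: "finite S" "S \<subseteq> {m..}" "card S = n" "\<And>i. i \<in> S \<Longrightarrow> \<gamma> i \<otimes> g \<in> R"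
      using good[OF g] by blast
    from mn[OF S(1,2)] S(3) obtain B where B: "B \<in> events"
      "determined_by M ((\<lambda>i. \<phi> (\<gamma> i) -` A) ` S) B" "prob ((C - B) \<union> (B - C)) \<le> (e / 3)\<^sup>2" by auto
    have gG: "g \<in> carrier G" using g F by auto
    have "\<phi> g -` (\<phi> (\<gamma> i) -` A) \<in> translates A R" if "i \<in> S" for i
    proof -
      have "\<gamma> i \<in> carrier G" using \<gamma>(2) by auto
      then have "\<phi> g -` (\<phi> (\<gamma> i) -` A) = \<phi> (\<gamma> i \<otimes> g) -` A"
        using gG by (auto simp: act_mult)
      with S(4)[OF that] show ?thesis by (auto simp: translates_def)
    qed
    then have "determined_by M (translates A R) (\<phi> g -` B)"
      by (intro determined_by_mono[OF determined_by_vimage[OF B(2) space_UNIV]]) (simp add: image_subset_iff)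
    with B show ?thesis by blast
  qed
  then obtain B where B: "\<And>g. g \<in> F N - bad \<Longrightarrow> B g \<in> events"
    "\<And>g. g \<in> F N - bad \<Longrightarrow> determined_by M (translates A R) (\<phi> g -` B g)"
    "\<And>g. g \<in> F N - bad \<Longrightarrow> prob ((C - B g) \<union> (B g - C)) \<le> (e / 3)\<^sup>2"
    by metis
  define X where "X g = \<phi> g -` ((C - B g) \<union> (B g - C))" for g
  have X_ev: "X g \<in> events" if "g \<in> F N - bad" for g
    unfolding X_def using that B(1)[OF that] C F by (intro act_vimage_events) auto
  let ?T = "translates A R" and ?Y = "translates C bad"
  have fin: "finite bad" "finite (F N - bad)" using F bad finite_subset by auto
  have T: "finite ?T" "?T \<subseteq> events" using R A by (auto intro: finite_translates translates_events[THEN subsetD])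
  have badG: "bad \<subseteq> carrier G" using bad F by blast
  have Y: "finite ?Y" "?Y \<subseteq> events"
    by (rule finite_translates[OF fin(1)]) (rule translates_events[OF C badG])
  have X_img: "X ` (F N - bad) \<subseteq> events" using X_ev by (rule image_subsetI)
  have "orbit_entropy C (F N) \<le> family_entropy M (X ` (F N - bad) \<union> (?Y \<union> ?T))"
    unfolding orbit_entropy_def
  proof (rule family_entropy_le_if_determined)
    fix D assume "D \<in> translates C (F N)"
    then obtain g where g: "g \<in> F N" "D = \<phi> g -` C" by (auto simp: translates_def)
    show "determined_by M (X ` (F N - bad) \<union> (?Y \<union> ?T)) D"
    proof (cases "g \<in> bad")
      case True
      then have "D \<in> X ` (F N - bad) \<union> (?Y \<union> ?T)" using g by (auto simp: translates_def)
      then show ?thesis by (simp add: determined_by_def)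
    next
      case False
      with g have g': "g \<in> F N - bad" by simp
      have "X g = (\<phi> g -` C - \<phi> g -` B g) \<union> (\<phi> g -` B g - \<phi> g -` C)" by (auto simp: X_def)
      then have "determined_by M (insert (X g) ?T) D"
        using determined_by_via_difference[OF B(2)[OF g'], of "\<phi> g -` C"] g(2) by simp
      moreover have "insert (X g) ?T \<subseteq> X ` (F N - bad) \<union> (?Y \<union> ?T)" using g' by blast
      ultimately show ?thesis by (rule determined_by_mono)
    qed
  next
    show "finite (X ` (F N - bad) \<union> (?Y \<union> ?T))" using fin T Y by simp
    show "X ` (F N - bad) \<union> (?Y \<union> ?T) \<subseteq> events" using X_img T Y by simp
  qed (intro finite_translates translates_events C F)+
  also have "\<dots> \<le> family_entropy M (?Y \<union> ?T) + real (card (F N - bad)) * e"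
  proof (rule family_entropy_Un_image_le)
    fix g assume g: "g \<in> F N - bad"
    have "family_entropy M {X g} \<le> 3 * sqrt (prob (X g))"
      using X_ev[OF g] by (rule family_entropy_singleton_le_sqrt)
    also have "prob (X g) = prob ((C - B g) \<union> (B g - C))"
      unfolding X_def using g F B(1)[OF g] C by (intro act_prob) auto
    also have "sqrt \<dots> \<le> sqrt ((e / 3)\<^sup>2)" using B(3)[OF g] by (rule real_sqrt_le_mono)
    also have "\<dots> = e / 3" using e by simp
    finally show "family_entropy M {X g} \<le> e" by simp
    show "X g \<in> events" by (rule X_ev[OF g])
  qed (use fin T Y in simp_all)
  finally have "orbit_entropy C (F N) \<le> family_entropy M (?Y \<union> ?T) + real (card (F N - bad)) * e" .
  moreover have "family_entropy M (?Y \<union> ?T) \<le> family_entropy M ?Y + family_entropy M ?T"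
    using T Y by (intro family_entropy_Un_le)
  moreover have "family_entropy M ?Y \<le> 2 * real (card bad)"
    by (rule translates_entropy_le[OF C badG fin(1)])
  moreover have "family_entropy M ?T \<le> 2 * real (card R)"
    by (rule translates_entropy_le[OF A R])
  moreover have "real (card (F N - bad)) * e \<le> real (card (F N)) * e"
    using e F by (intro mult_right_mono) (auto intro: card_mono)
  moreover have "\<epsilon> * real (card (F N)) = 5 * (e * real (card (F N)))" by (simp add: e_def)
  ultimately have "orbit_entropy C (F N) \<le> \<epsilon> * real (card (F N))"
    using small unfolding mult.commute[of _ e] by linarith
  then show "\<exists>K. finite K \<and> K \<noteq> {} \<and> K \<subseteq> carrier G \<and> orbit_entropy C K \<le> \<epsilon> * real (card K)"
    by (intro exI[of _ "F N"] conjI F)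
qed

text \<open>The Pinsker algebra in the form of a measure space, which measurability and conditional expectation
  refer to.\<close>

definition pinsker :: "'x measure" where
  "pinsker = sigma (space M) (pinsker_algebra G \<phi> M)"

lemma sets_pinsker:
  assumes "amenable G"
  shows "sets pinsker = pinsker_algebra G \<phi> M" "space pinsker = UNIV"
  using sigma_algebra.sets_measure_of_eq[OF pinsker_algebra_sigma_algebra[OF assms]]
  by (simp_all add: pinsker_def space_UNIV)

text \<open>Otherwise the limit \<open>u\<close> of the frequencies of infinitely many such translates would be measurable with
  respect to the Pinsker algebra, as its level sets have entropy rate \<open>0\<close>, and still satisfy
  \<open>(\<integral>x. u x * v x) \<ge> c\<close>.\<close>

lemma finite_large_correlation:
  assumes am: "amenable G" and A: "A \<in> events" and v: "v \<in> L2 M" and c: "c > 0"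
    and orth: "\<And>u. u \<in> borel_measurable pinsker \<Longrightarrow> (\<And>x. u x \<in> {0..1}) \<Longrightarrow> (\<integral>x. u x * v x \<partial>M) = 0"
  shows "finite {k \<in> carrier G. c \<le> (\<integral>x. indicator A (\<phi> k x) * v x \<partial>M)}"
proof (rule ccontr)
  assume "infinite {k \<in> carrier G. c \<le> (\<integral>x. indicator A (\<phi> k x) * v x \<partial>M)}"
  then obtain \<gamma>0 :: "nat \<Rightarrow> 'g" where "inj \<gamma>0" "range \<gamma>0 \<subseteq> {k \<in> carrier G. c \<le> (\<integral>x. indicator A (\<phi> k x) * v x \<partial>M)}"
    by (meson infinite_countable_subset)
  then have \<gamma>0: "inj \<gamma>0" "\<And>i. \<gamma>0 i \<in> carrier G" "\<And>i. c \<le> (\<integral>x. indicator A (\<phi> (\<gamma>0 i) x) * v x \<partial>M)"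
    by blast+
  define corr where "corr i j = prob (\<phi> (\<gamma>0 i) -` A \<inter> \<phi> (\<gamma>0 j) -` A)" for i j
  have "corr i j \<in> {0..1}" for i j by (simp add: corr_def)
  then obtain r :: "nat \<Rightarrow> nat" and a :: real where r: "strict_mono r" and a: "a \<in> {0..1}" and close: "\<And>\<epsilon>. \<epsilon> > 0 \<Longrightarrow>
      \<exists>m. \<forall>i j. m \<le> i \<longrightarrow> i < j \<longrightarrow> \<bar>corr (r i) (r j) - a\<bar> \<le> \<epsilon>"
    using asymptotically_constant_subarray[of corr] by metis
  define \<gamma> where "\<gamma> i = \<gamma>0 (r i)" for i
  have \<gamma>: "inj \<gamma>" "range \<gamma> \<subseteq> carrier G"
    using inj_compose[OF \<gamma>0(1) strict_mono_imp_inj_on[OF r]] \<gamma>0(2) by (auto simp: \<gamma>_def[abs_def] o_def)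
  define E where "E i = \<phi> (\<gamma> i) -` A" for i
  have E: "E i \<in> events" for i unfolding E_def using \<gamma>(2) A by (intro act_vimage_events) auto
  have closeE: "\<exists>m. \<forall>i j. m \<le> i \<longrightarrow> i < j \<longrightarrow> \<bar>prob (E i \<inter> E j) - a\<bar> \<le> \<epsilon>" if "\<epsilon> > 0" for \<epsilon>
    using close[OF that] by (simp only: corr_def E_def \<gamma>_def)
  obtain u :: "'x \<Rightarrow> real" where u: "u \<in> borel_measurable M" "\<And>x. u x \<in> {0..1}" and lim:
    "\<And>\<epsilon>. \<epsilon> > 0 \<Longrightarrow> \<exists>m n. \<forall>S. finite S \<longrightarrow> S \<subseteq> {m..} \<longrightarrow> n \<le> card S \<longrightarrow>
        (\<integral>x. (frequency E S x - u x)\<^sup>2 \<partial>M) \<le> \<epsilon>"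
    using frequency_L2_limit[OF E a closeE] by metis
  have "entropy_rate {x \<in> space M. t < u x} = 0" for t
  proof (rule entropy_rate_eq_0_if_determined_far_away[OF am A _ \<gamma>])
    show "{x \<in> space M. t < u x} \<in> events" using u(1) by measurable
    fix \<delta> :: real assume "\<delta> > 0"
    from level_set_approx[OF E u lim this, of t]
    show "\<exists>m n. \<forall>S. finite S \<longrightarrow> S \<subseteq> {m..} \<longrightarrow> n \<le> card S \<longrightarrow>
       (\<exists>B\<in>events. determined_by M ((\<lambda>i. \<phi> (\<gamma> i) -` A) ` S) B \<and>
          prob (({x \<in> space M. t < u x} - B) \<union> (B - {x \<in> space M. t < u x})) \<le> \<delta>)"
      unfolding E_def[abs_def] .
  qed
  then have "u \<in> borel_measurable pinsker"
    using u(1) unfolding borel_measurable_iff_greater sets_pinsker[OF am] pinsker_algebra_iff[OF am]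
    by (simp add: space_UNIV)
  then have uv: "(\<integral>x. u x * v x \<partial>M) = 0" using u(2) by (rule orth)
  have uL: "u \<in> L2 M" using u by (intro bounded_in_L2[where c = 1]) (auto simp: abs_le_iff intro: order_trans[of _ 0])
  define b where "b = L2_norm M v + 1"
  have b: "b > 0" "L2_norm M v < b" by (auto simp: b_def L2_norm_def add_nonneg_pos)
  have "(c / b)\<^sup>2 > 0" using b c by simp
  from lim[OF this] obtain m n where mn: "\<And>S. finite S \<Longrightarrow> S \<subseteq> {m..} \<Longrightarrow> n \<le> card S \<Longrightarrow>
        (\<integral>x. (frequency E S x - u x)\<^sup>2 \<partial>M) \<le> (c / b)\<^sup>2" by blast
  \<comment> \<open>nonempty even if \<open>n = 0\<close>\<close>
  define S where "S = {m..m + n}"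
  have S: "finite S" "S \<noteq> {}" "card S > 0" by (auto simp: S_def)
  let ?f = "frequency E S"
  have fL: "?f \<in> L2 M" using E by (intro frequency_L2)
  have int: "integrable M (\<lambda>x. indicator (E i) x * v x)" for i
    using E[of i] by (intro integrable_mult_L2[OF _ v] bounded_in_L2[where c = 1]) (auto simp: indicator_def)
  have "real (card S) * c \<le> (\<Sum>i\<in>S. \<integral>x. indicator (E i) x * v x \<partial>M)"
  proof -
    have "c \<le> (\<integral>x. indicator (E i) x * v x \<partial>M)" for i
      using \<gamma>0(3)[of "r i"] by (simp add: E_def \<gamma>_def indicator_vimage o_def)
    then have "(\<Sum>i\<in>S. c) \<le> (\<Sum>i\<in>S. \<integral>x. indicator (E i) x * v x \<partial>M)" by (intro sum_mono)
    then show ?thesis by simp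
  qed
  also have "\<dots> = (\<integral>x. (\<Sum>i\<in>S. indicator (E i) x * v x) \<partial>M)"
    using int by (simp add: Bochner_Integration.integral_sum)
  also have "\<dots> = (\<integral>x. real (card S) * (?f x * v x) \<partial>M)"
    using S by (simp add: frequency_def sum_distrib_right)
  finally have "real (card S) * c \<le> real (card S) * (\<integral>x. ?f x * v x \<partial>M)" by simp
  then have "c \<le> (\<integral>x. ?f x * v x \<partial>M)" using S(3) by simp
  also have "\<dots> = (\<integral>x. (?f x - u x) * v x \<partial>M)"
    using integrable_mult_L2[OF fL v] integrable_mult_L2[OF uL v] uv by (simp add: left_diff_distrib)
  also have "\<dots> \<le> L2_norm M (\<lambda>x. ?f x - u x) * L2_norm M v"
    using L2_Cauchy_Schwarz[OF L2_diff[OF fL uL] v] by linarith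
  also have "\<dots> \<le> (c / b) * L2_norm M v"
  proof (rule mult_right_mono)
    have "(\<integral>x. (?f x - u x)\<^sup>2 \<partial>M) \<le> (c / b)\<^sup>2" by (rule mn) (auto simp: S_def)
    then show "L2_norm M (\<lambda>x. ?f x - u x) \<le> c / b"
      unfolding L2_norm_def using b c by (intro real_le_lsqrt) auto
  qed (simp add: L2_norm_def)
  also have "\<dots> < (c / b) * b" using b c by (intro mult_strict_left_mono) auto
  finally show False using b by simp
qed

end

section \<open>Decay of correlations and averages\<close>

lemma L2_simple_approx:
  assumes f: "f \<in> L2 M" and \<epsilon>: "\<epsilon> > 0"
  obtains s where "simple_function M s" "s \<in> L2 M" "L2_norm M (\<lambda>x. f x - s x) < \<epsilon>"
proof -
  have f_meas [measurable]: "f \<in> borel_measurable M" and f_int: "integrable M (\<lambda>x. (f x)\<^sup>2)"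
    using f by (auto simp: L2_def)
  obtain s where s: "\<And>i. simple_function M (s i)" "\<And>x. x \<in> space M \<Longrightarrow> (\<lambda>i. s i x) \<longlonglongrightarrow> f x"
    "\<And>i x. x \<in> space M \<Longrightarrow> dist (s i x) 0 \<le> 2 * dist (f x) 0"
    using borel_measurable_implies_sequence_metric[OF f_meas, of 0] by blast
  have s_meas [measurable]: "s i \<in> borel_measurable M" for i using s(1) by (rule borel_measurable_simple_function)
  have sq: "(s i x)\<^sup>2 \<le> 4 * (f x)\<^sup>2" "(f x - s i x)\<^sup>2 \<le> 9 * (f x)\<^sup>2" if "x \<in> space M" for i x
  proof -
    have "\<bar>s i x\<bar> \<le> \<bar>2 * f x\<bar>" using s(3)[OF that, of i] by simp
    then have "(s i x)\<^sup>2 \<le> (2 * f x)\<^sup>2" "\<bar>f x - s i x\<bar> \<le> \<bar>3 * f x\<bar>"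
      unfolding abs_le_square_iff[symmetric] by linarith+
    then show "(s i x)\<^sup>2 \<le> 4 * (f x)\<^sup>2" "(f x - s i x)\<^sup>2 \<le> 9 * (f x)\<^sup>2"
      unfolding abs_le_square_iff by (simp_all add: power_mult_distrib)
  qed
  have sL: "s i \<in> L2 M" for i
    unfolding L2_def
  proof (intro CollectI conjI s_meas)
    show "integrable M (\<lambda>x. (s i x)\<^sup>2)"
      by (rule Bochner_Integration.integrable_bound[of M "\<lambda>x. 4 * (f x)\<^sup>2"])
        (use f_int sq in \<open>auto intro!: AE_I2\<close>)
  qed
  have "(\<lambda>i. \<integral>x. (f x - s i x)\<^sup>2 \<partial>M) \<longlonglongrightarrow> (\<integral>x. 0 \<partial>M)"
  proof (rule integral_dominated_convergence[where w = "\<lambda>x. 9 * (f x)\<^sup>2"])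
    show "AE x in M. (\<lambda>i. (f x - s i x)\<^sup>2) \<longlonglongrightarrow> 0"
    proof (rule AE_I2)
      fix x assume "x \<in> space M"
      then have "(\<lambda>i. (f x - s i x)\<^sup>2) \<longlonglongrightarrow> (f x - f x)\<^sup>2" by (intro tendsto_intros s(2))
      then show "(\<lambda>i. (f x - s i x)\<^sup>2) \<longlonglongrightarrow> 0" by simp
    qed
    show "\<And>i. AE x in M. norm ((f x - s i x)\<^sup>2) \<le> 9 * (f x)\<^sup>2"
      using sq(2) by (intro AE_I2) simp
  qed (use f_int in auto)
  then have "(\<lambda>i. L2_norm M (\<lambda>x. f x - s i x)) \<longlonglongrightarrow> sqrt (\<integral>x. 0 \<partial>M)"
    unfolding L2_norm_def by (rule tendsto_real_sqrt)
  then have "(\<lambda>i. L2_norm M (\<lambda>x. f x - s i x)) \<longlonglongrightarrow> 0" by simp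
  then have "eventually (\<lambda>i. L2_norm M (\<lambda>x. f x - s i x) < \<epsilon>) sequentially"
    by (rule order_tendstoD) (rule \<epsilon>)
  then obtain i where "L2_norm M (\<lambda>x. f x - s i x) < \<epsilon>" by (auto simp: eventually_sequentially)
  with that[OF s(1) sL] show thesis by blast
qed

lemma simple_function_eq_sum_indicator:
  fixes s :: "'a \<Rightarrow> real"
  assumes "simple_function M s" "x \<in> space M"
  shows "s x = (\<Sum>y\<in>s ` space M. y * indicator (s -` {y} \<inter> space M) x)"
proof -
  have "(\<Sum>y\<in>s ` space M. y * indicator (s -` {y} \<inter> space M) x) = (\<Sum>y\<in>s ` space M. if y = s x then y else 0)"
    using assms(2) by (intro sum.cong) (auto simp: indicator_def)
  then show ?thesis using assms by (simp add: simple_function_def)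
qed

context mp_action
begin

lemma distr_act: "g \<in> carrier G \<Longrightarrow> distr M M (\<phi> g) = M"
proof (rule measure_eqI)
  fix A assume g: "g \<in> carrier G" and "A \<in> sets (distr M M (\<phi> g))"
  then have A: "A \<in> events" by simp
  with g show "emeasure (distr M M (\<phi> g)) A = emeasure M A"
    by (simp add: emeasure_distr space_UNIV emeasure_eq_measure act_prob)
qed simp

lemma L2_act: "f \<in> L2 M \<Longrightarrow> g \<in> carrier G \<Longrightarrow> (\<lambda>x. f (\<phi> g x)) \<in> L2 M"
  using integrable_distr_eq[of "\<phi> g" M M "\<lambda>x. (f x)\<^sup>2"]
  by (auto simp: L2_def distr_act intro: measurable_compose[OF act_measurable])

lemma integral_act:
  assumes "f \<in> borel_measurable M" "g \<in> carrier G"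
  shows "(\<integral>x. f (\<phi> g x) \<partial>M) = (\<integral>x. (f x :: real) \<partial>M)"
  using integral_distr[of "\<phi> g" M M f] assms by (simp add: distr_act)

lemma L2_norm_act: "f \<in> L2 M \<Longrightarrow> g \<in> carrier G \<Longrightarrow> L2_norm M (\<lambda>x. f (\<phi> g x)) = L2_norm M f"
  unfolding L2_norm_def L2_def by (simp add: integral_act[OF borel_measurable_power])

text \<open>Limits along this filter are limits as the group element leaves every finite subset of the group.\<close>

definition leaving :: "'g filter" where
  "leaving = inf cofinite (principal (carrier G))"

lemma eventually_leaving: "eventually P leaving \<longleftrightarrow> finite {k \<in> carrier G. \<not> P k}"
  unfolding leaving_def eventually_inf_principal eventually_cofinite by (simp add: Collect_conj_eq conj_commute)

lemma indicator_mixing: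
  assumes am: "amenable G" and A: "A \<in> events" and v: "v \<in> L2 M"
    and orth: "\<And>u. u \<in> borel_measurable pinsker \<Longrightarrow> (\<And>x. u x \<in> {0..1}) \<Longrightarrow> (\<integral>x. u x * v x \<partial>M) = 0"
  shows "((\<lambda>k. \<integral>x. indicator A (\<phi> k x) * v x \<partial>M) \<longlongrightarrow> 0) leaving"
proof (rule tendstoI)
  fix c :: real assume c: "c > 0"
  have v': "(\<lambda>x. - v x) \<in> L2 M" using L2_cmult[OF v, of "-1"] by simp
  have "finite ({k \<in> carrier G. c \<le> (\<integral>x. indicator A (\<phi> k x) * v x \<partial>M)} \<union>
     {k \<in> carrier G. c \<le> (\<integral>x. indicator A (\<phi> k x) * - v x \<partial>M)})"
    using finite_large_correlation[OF am A v c orth] finite_large_correlation[OF am A v' c] orth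
    by (intro finite_UnI) auto
  moreover have "{k \<in> carrier G. \<not> dist (\<integral>x. indicator A (\<phi> k x) * v x \<partial>M) 0 < c} \<subseteq> \<dots>"
    by (auto simp: not_less abs_if split: if_splits)
  ultimately show "eventually (\<lambda>k. dist (\<integral>x. indicator A (\<phi> k x) * v x \<partial>M) 0 < c) leaving"
    unfolding eventually_leaving by (rule finite_subset[rotated])
qed

lemma L2_mixing:
  assumes am: "amenable G" and f: "f \<in> L2 M" and v: "v \<in> L2 M"
    and orth: "\<And>u. u \<in> borel_measurable pinsker \<Longrightarrow> (\<And>x. u x \<in> {0..1}) \<Longrightarrow> (\<integral>x. u x * v x \<partial>M) = 0"
  shows "((\<lambda>k. \<integral>x. f (\<phi> k x) * v x \<partial>M) \<longlongrightarrow> 0) leaving"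
proof (rule tendstoI)
  fix \<epsilon> :: real assume \<epsilon>: "\<epsilon> > 0"
  define b where "b = L2_norm M v + 1"
  have b: "b > 0" "L2_norm M v \<le> b" "0 \<le> L2_norm M v" by (auto simp: b_def L2_norm_def add_nonneg_pos)
  have "\<epsilon> / (2 * b) > 0" using \<epsilon> b by simp
  then obtain s where s: "simple_function M s" "s \<in> L2 M" "L2_norm M (\<lambda>x. f x - s x) < \<epsilon> / (2 * b)"
    using L2_simple_approx[OF f] by blast
  let ?Y = "s ` space M" and ?A = "\<lambda>y. s -` {y} \<inter> space M"
  have A: "?A y \<in> events" for y using s(1) by (rule simple_functionD)
  have "((\<lambda>k. \<Sum>y\<in>?Y. y * (\<integral>x. indicator (?A y) (\<phi> k x) * v x \<partial>M)) \<longlongrightarrow> (\<Sum>y\<in>?Y. y * 0)) leaving"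
    using indicator_mixing[OF am A v orth] by (intro tendsto_sum tendsto_mult_left) blast
  then have "((\<lambda>k. \<Sum>y\<in>?Y. y * (\<integral>x. indicator (?A y) (\<phi> k x) * v x \<partial>M)) \<longlongrightarrow> 0) leaving" by simp
  then have "eventually (\<lambda>k. dist (\<Sum>y\<in>?Y. y * (\<integral>x. indicator (?A y) (\<phi> k x) * v x \<partial>M)) 0 < \<epsilon> / 2) leaving"
    using \<epsilon> by (intro tendstoD) auto
  moreover have "eventually (\<lambda>k. k \<in> carrier G) leaving" by (simp add: eventually_leaving)
  ultimately show "eventually (\<lambda>k. dist (\<integral>x. f (\<phi> k x) * v x \<partial>M) 0 < \<epsilon>) leaving"
  proof eventually_elim
    case (elim k)
    note k = elim(2)
    have int: "integrable M (\<lambda>x. indicator (?A y) (\<phi> k x) * v x)" for y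
      using A[of y] k by (intro integrable_mult_L2[OF _ v] L2_act[of "indicator (?A y)"] bounded_in_L2[where c = 1]) (auto simp: indicator_def)
    have "(\<integral>x. s (\<phi> k x) * v x \<partial>M) = (\<integral>x. (\<Sum>y\<in>?Y. y * (indicator (?A y) (\<phi> k x) * v x)) \<partial>M)"
    proof (rule Bochner_Integration.integral_cong[OF refl])
      fix x
      have "s (\<phi> k x) = (\<Sum>y\<in>?Y. y * indicator (?A y) (\<phi> k x))"
        by (rule simple_function_eq_sum_indicator[OF s(1)]) (simp add: space_UNIV)
      then have "s (\<phi> k x) * v x = (\<Sum>y\<in>?Y. y * indicator (?A y) (\<phi> k x)) * v x"
        by (rule arg_cong)
      then show "s (\<phi> k x) * v x = (\<Sum>y\<in>?Y. y * (indicator (?A y) (\<phi> k x) * v x))"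
        by (simp only: sum_distrib_right mult.assoc)
    qed
    also have "\<dots> = (\<Sum>y\<in>?Y. y * (\<integral>x. indicator (?A y) (\<phi> k x) * v x \<partial>M))"
      using int by (simp add: Bochner_Integration.integral_sum)
    finally have 1: "\<bar>\<integral>x. s (\<phi> k x) * v x \<partial>M\<bar> < \<epsilon> / 2" using elim(1) by simp
    have d: "(\<lambda>x. f x - s x) \<in> L2 M" using f s(2) by (rule L2_diff)
    have "\<bar>\<integral>x. (f (\<phi> k x) - s (\<phi> k x)) * v x \<partial>M\<bar> \<le> L2_norm M (\<lambda>x. f (\<phi> k x) - s (\<phi> k x)) * L2_norm M v"
      using L2_Cauchy_Schwarz[OF L2_act[OF d k] v] by simp
    also have "\<dots> = L2_norm M (\<lambda>x. f x - s x) * L2_norm M v"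
      using L2_norm_act[OF d k] by simp
    also have "\<dots> \<le> \<epsilon> / (2 * b) * b"
      using s(3) b \<epsilon> by (intro mult_mono) auto
    also have "\<dots> = \<epsilon> / 2" using b by simp
    finally have 2: "\<bar>\<integral>x. (f (\<phi> k x) - s (\<phi> k x)) * v x \<partial>M\<bar> \<le> \<epsilon> / 2" .
    have "(\<integral>x. (f (\<phi> k x) - s (\<phi> k x)) * v x \<partial>M) = (\<integral>x. f (\<phi> k x) * v x \<partial>M) - (\<integral>x. s (\<phi> k x) * v x \<partial>M)"
      using integrable_mult_L2[OF L2_act[OF f k] v] integrable_mult_L2[OF L2_act[OF s(2) k] v]
      by (simp add: left_diff_distrib)
    with 1 2 have "\<bar>\<integral>x. f (\<phi> k x) * v x \<partial>M\<bar> < \<epsilon>" by linarith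
    then show ?case by simp
  qed
qed

text \<open>By invariance the squared norm of the average is the mean of \<open>\<rho> (g \<otimes> inv h)\<close> over
  \<open>S n \<times> S n\<close>. For fixed \<open>g\<close> the map \<open>h \<mapsto> g \<otimes> inv h\<close> is injective, so at most \<open>card B\<close> of
  the terms in a row are not small, where \<open>B\<close> is the finite set of group elements with large
  correlation.\<close>

lemma averages_vanish_if_mixing:
  assumes v: "v \<in> L2 M" and mix: "((\<lambda>k. \<integral>x. v (\<phi> k x) * v x \<partial>M) \<longlongrightarrow> 0) leaving"
    and S: "\<And>n. n \<ge> 1 \<Longrightarrow> S n \<subseteq> carrier G \<and> finite (S n) \<and> S n \<noteq> {}"
    and card: "filterlim (\<lambda>n. card (S n)) at_top sequentially"
  shows "(\<lambda>n. L2_norm M (ergodic_average \<phi> (S n) v)) \<longlonglongrightarrow> 0"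
proof -
  define \<rho> where "\<rho> k = (\<integral>x. v (\<phi> k x) * v x \<partial>M)" for k
  define V where "V = L2_norm M v * L2_norm M v"
  have V: "0 \<le> V" by (simp add: V_def L2_norm_def)
  have \<rho>_le: "\<bar>\<rho> k\<bar> \<le> V" if "k \<in> carrier G" for k
    using L2_Cauchy_Schwarz[OF L2_act[OF v that] v] by (simp add: \<rho>_def V_def L2_norm_act[OF v that])
  have norm_sq: "(\<integral>x. (ergodic_average \<phi> T v x)\<^sup>2 \<partial>M) = (\<Sum>g\<in>T. \<Sum>h\<in>T. \<rho> (g \<otimes> inv h)) / (real (card T))\<^sup>2"
    if T: "T \<subseteq> carrier G" for T
  proof -
    have int: "integrable M (\<lambda>x. v (\<phi> g x) * v (\<phi> h x))" if "g \<in> T" "h \<in> T" for g h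
      using that T by (intro integrable_mult_L2 L2_act v) auto
    have "(\<integral>x. (ergodic_average \<phi> T v x)\<^sup>2 \<partial>M) = (\<integral>x. (\<Sum>g\<in>T. \<Sum>h\<in>T. v (\<phi> g x) * v (\<phi> h x)) / (real (card T))\<^sup>2 \<partial>M)"
      by (simp add: ergodic_average_def power2_eq_square sum_product)
    also have "\<dots> = (\<integral>x. (\<Sum>g\<in>T. \<Sum>h\<in>T. v (\<phi> g x) * v (\<phi> h x)) \<partial>M) / (real (card T))\<^sup>2"
      by simp
    also have "(\<integral>x. (\<Sum>g\<in>T. \<Sum>h\<in>T. v (\<phi> g x) * v (\<phi> h x)) \<partial>M) = (\<Sum>g\<in>T. \<integral>x. (\<Sum>h\<in>T. v (\<phi> g x) * v (\<phi> h x)) \<partial>M)"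
      using int by (intro Bochner_Integration.integral_sum Bochner_Integration.integrable_sum)
    also have "\<dots> = (\<Sum>g\<in>T. \<Sum>h\<in>T. \<integral>x. v (\<phi> g x) * v (\<phi> h x) \<partial>M)"
      using int by (intro sum.cong refl Bochner_Integration.integral_sum)
    also have "\<dots> = (\<Sum>g\<in>T. \<Sum>h\<in>T. \<rho> (g \<otimes> inv h))"
    proof (intro sum.cong refl)
      fix g h assume "g \<in> T" "h \<in> T"
      then have gh: "g \<in> carrier G" "h \<in> carrier G" using T by auto
      have "\<phi> g x = \<phi> (g \<otimes> inv h) (\<phi> h x)" for x
        using gh by (subst act_mult[symmetric]) (auto simp: m_assoc)
      then have "(\<integral>x. v (\<phi> g x) * v (\<phi> h x) \<partial>M) = (\<integral>x. v (\<phi> (g \<otimes> inv h) (\<phi> h x)) * v (\<phi> h x) \<partial>M)" by simp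
      also have "\<dots> = \<rho> (g \<otimes> inv h)"
        unfolding \<rho>_def using gh v L2_act[OF v, of "g \<otimes> inv h"]
        by (intro integral_act[of "\<lambda>x. v (\<phi> (g \<otimes> inv h) x) * v x"]) (auto simp: L2_def)
      finally show "(\<integral>x. v (\<phi> g x) * v (\<phi> h x) \<partial>M) = \<rho> (g \<otimes> inv h)" .
    qed
    finally show ?thesis .
  qed
  have "(\<lambda>n. \<integral>x. (ergodic_average \<phi> (S n) v x)\<^sup>2 \<partial>M) \<longlonglongrightarrow> 0"
  proof (rule tendstoI)
    fix \<epsilon> :: real assume \<epsilon>: "\<epsilon> > 0"
    define B where "B = {k \<in> carrier G. \<not> \<bar>\<rho> k\<bar> < \<epsilon> / 2}"
    have "eventually (\<lambda>k. dist (\<rho> k) 0 < \<epsilon> / 2) leaving"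
      using mix \<epsilon> unfolding \<rho>_def by (intro tendstoD) auto
    then have finB: "finite B" by (simp add: eventually_leaving B_def)
    have "((\<lambda>n. real (card B) * V / real (card (S n))) \<longlongrightarrow> 0) sequentially"
      by (intro tendsto_divide_0[OF tendsto_const] filterlim_at_top_imp_at_infinity filterlim_compose[OF filterlim_real_sequentially card])
    then have "eventually (\<lambda>n. real (card B) * V / real (card (S n)) < \<epsilon> / 2) sequentially"
      by (rule order_tendstoD) (use \<epsilon> in simp)
    moreover have "eventually (\<lambda>n. n \<ge> 1) sequentially" by (rule eventually_ge_at_top)
    ultimately show "eventually (\<lambda>n. dist (\<integral>x. (ergodic_average \<phi> (S n) v x)\<^sup>2 \<partial>M) 0 < \<epsilon>) sequentially"
    proof eventually_elim
      case (elim n)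
      let ?T = "S n"
      have T: "?T \<subseteq> carrier G" "finite ?T" "?T \<noteq> {}" using S[OF elim(2)] by auto
      have c: "real (card ?T) > 0" using T by (simp add: card_gt_0_iff)
      have row: "(\<Sum>h\<in>?T. \<bar>\<rho> (g \<otimes> inv h)\<bar>) \<le> real (card ?T) * (\<epsilon> / 2) + real (card B) * V" if g: "g \<in> ?T" for g
      proof -
        have gG: "g \<in> carrier G" using g T by auto
        have "(\<Sum>h\<in>?T. \<bar>\<rho> (g \<otimes> inv h)\<bar>) \<le> (\<Sum>h\<in>?T. \<epsilon> / 2 + of_bool (g \<otimes> inv h \<in> B) * V)"
        proof (rule sum_mono)
          fix h assume "h \<in> ?T"
          then have "g \<otimes> inv h \<in> carrier G" using gG T by auto
          then show "\<bar>\<rho> (g \<otimes> inv h)\<bar> \<le> \<epsilon> / 2 + of_bool (g \<otimes> inv h \<in> B) * V"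
            using \<rho>_le[of "g \<otimes> inv h"] \<epsilon> V by (cases "g \<otimes> inv h \<in> B") (auto simp: B_def)
        qed
        also have "\<dots> = real (card ?T) * (\<epsilon> / 2) + real (card {h \<in> ?T. g \<otimes> inv h \<in> B}) * V"
          using T by (simp add: sum.distrib sum_distrib_right[symmetric] of_bool_def sum.If_cases Int_def)
        also have "card {h \<in> ?T. g \<otimes> inv h \<in> B} \<le> card B"
        proof (rule card_inj_on_le[of "\<lambda>h. g \<otimes> inv h"])
          show "inj_on (\<lambda>h. g \<otimes> inv h) {h \<in> ?T. g \<otimes> inv h \<in> B}"
          proof (rule inj_onI)
            fix h h' assume "h \<in> {h \<in> ?T. g \<otimes> inv h \<in> B}" "h' \<in> {h \<in> ?T. g \<otimes> inv h \<in> B}" and eq: "g \<otimes> inv h = g \<otimes> inv h'"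
            then have "h \<in> carrier G" "h' \<in> carrier G" using T by auto
            with eq gG have "inv h = inv h'" by simp
            then show "h = h'" using \<open>h \<in> carrier G\<close> \<open>h' \<in> carrier G\<close> by (metis inv_inv)
          qed
        qed (use finB in auto)
        finally show ?thesis using V by (simp add: mult_right_mono)
      qed
      have "\<bar>\<Sum>g\<in>?T. \<Sum>h\<in>?T. \<rho> (g \<otimes> inv h)\<bar> \<le> (\<Sum>g\<in>?T. \<Sum>h\<in>?T. \<bar>\<rho> (g \<otimes> inv h)\<bar>)"
        by (intro order_trans[OF sum_abs] sum_mono sum_abs)
      also have "\<dots> \<le> (\<Sum>g\<in>?T. real (card ?T) * (\<epsilon> / 2) + real (card B) * V)"
        by (intro sum_mono row)
      also have "\<dots> = (real (card ?T))\<^sup>2 * (\<epsilon> / 2 + real (card B) * V / real (card ?T))"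
        using c by (simp add: power2_eq_square field_simps)
      finally have "\<bar>\<Sum>g\<in>?T. \<Sum>h\<in>?T. \<rho> (g \<otimes> inv h)\<bar> / (real (card ?T))\<^sup>2 \<le> \<epsilon> / 2 + real (card B) * V / real (card ?T)"
        using c by (simp add: divide_le_eq mult.commute)
      moreover have "dist (\<integral>x. (ergodic_average \<phi> ?T v x)\<^sup>2 \<partial>M) 0
          = \<bar>\<Sum>g\<in>?T. \<Sum>h\<in>?T. \<rho> (g \<otimes> inv h)\<bar> / (real (card ?T))\<^sup>2"
        unfolding norm_sq[OF T(1)] by (simp add: abs_divide)
      ultimately show ?case using elim(1) by linarith
    qed
  qed
  then have "(\<lambda>n. sqrt (\<integral>x. (ergodic_average \<phi> (S n) v x)\<^sup>2 \<partial>M)) \<longlonglongrightarrow> sqrt 0"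
    by (rule tendsto_real_sqrt)
  then show ?thesis by (simp add: L2_norm_def)
qed

lemma measurable_act_pinsker:
  assumes "amenable G" "k \<in> carrier G"
  shows "\<phi> k \<in> measurable pinsker pinsker"
  using pinsker_algebra_vimage[OF assms(1) _ assms(2)]
  by (intro measurableI) (auto simp: sets_pinsker[OF assms(1)])

text \<open>With \<open>P = E(f | Pinsker)\<close> and \<open>v = f - P\<close>, the correlations of \<open>v\<close> with its translates agree with those
  of \<open>v\<close> with the translates of \<open>f\<close>: the translates of \<open>P\<close> are again Pinsker-measurable, by
  invariance of the Pinsker algebra, hence orthogonal to \<open>v\<close>.\<close>

theorem pinsker_algebra_characteristic:
  assumes am: "amenable G"
    and S: "\<And>n. n \<ge> 1 \<Longrightarrow> S n \<subseteq> carrier G \<and> finite (S n) \<and> S n \<noteq> {}"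
    and card: "filterlim (\<lambda>n. card (S n)) at_top sequentially"
  shows "characteristic_factor M \<phi> S (pinsker_algebra G \<phi> M)"
  unfolding characteristic_factor_def pinsker_def[symmetric]
proof (intro conjI ballI)
  show "sigma_algebra (space M) (pinsker_algebra G \<phi> M)" by (rule pinsker_algebra_sigma_algebra[OF am])
  show sub: "pinsker_algebra G \<phi> M \<subseteq> events" by (auto simp: pinsker_algebra_def)
  fix f assume f: "f \<in> L2 M"
  have subalg: "subalgebra M pinsker"
    using sub by (simp add: subalgebra_def sets_pinsker[OF am] space_UNIV)
  interpret finite_measure_subalgebra M pinsker by unfold_locales (rule subalg)
  define P where "P = real_cond_exp M pinsker f"
  have P_meas: "P \<in> borel_measurable pinsker" "P \<in> borel_measurable M" by (simp_all add: P_def)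
  have f_meas: "f \<in> borel_measurable M" using f by (simp add: L2_def)
  have P_L2: "P \<in> L2 M"
  proof -
    have "AE x in M. (P x)\<^sup>2 \<le> real_cond_exp M pinsker (\<lambda>x. (f x)\<^sup>2) x"
      unfolding P_def
    proof (rule real_cond_exp_jensens_inequality(2)[where q = "\<lambda>x. x\<^sup>2" and I = UNIV])
      show "integrable M f" using f by (rule L2_integrable)
      show "integrable M (\<lambda>x. (f x)\<^sup>2)" using f by (simp add: L2_def)
      show "convex_on UNIV (\<lambda>x::real. x\<^sup>2)" by (rule convex_power2)
    qed auto
    then have le: "AE x in M. norm ((P x)\<^sup>2) \<le> norm (real_cond_exp M pinsker (\<lambda>x. (f x)\<^sup>2) x)"
      by eventually_elim simp
    have "integrable M (real_cond_exp M pinsker (\<lambda>x. (f x)\<^sup>2))"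
      using f by (intro real_cond_exp_int) (simp add: L2_def)
    then have "integrable M (\<lambda>x. (P x)\<^sup>2)"
      using P_meas(2) le by (intro Bochner_Integration.integrable_bound[OF _ borel_measurable_power])
    then show ?thesis using P_meas by (simp add: L2_def)
  qed
  define v where "v = (\<lambda>x. f x - P x)"
  have v: "v \<in> L2 M" unfolding v_def using f P_L2 by (rule L2_diff)
  have orth: "(\<integral>x. w x * v x \<partial>M) = 0" if w: "w \<in> borel_measurable pinsker" "w \<in> L2 M" for w
  proof -
    have "(\<integral>x. w x * P x \<partial>M) = (\<integral>x. w x * f x \<partial>M)"
      unfolding P_def by (rule real_cond_exp_intg(2)[OF integrable_mult_L2[OF w(2) f] w(1) f_meas])
    then show ?thesis
      using integrable_mult_L2[OF w(2) f] integrable_mult_L2[OF w(2) P_L2]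
      by (simp add: v_def right_diff_distrib)
  qed
  have orth': "(\<integral>x. u x * v x \<partial>M) = 0" if u: "u \<in> borel_measurable pinsker" "\<And>x. u x \<in> {0..1}" for u
  proof (rule orth[OF u(1)])
    show "u \<in> L2 M"
    proof (rule bounded_in_L2)
      show "u \<in> borel_measurable M" by (rule measurable_from_subalg[OF subalg u(1)])
      show "\<bar>u x\<bar> \<le> 1" for x using u(2)[of x] by simp
    qed
  qed
  have "((\<lambda>k. \<integral>x. f (\<phi> k x) * v x \<partial>M) \<longlongrightarrow> 0) leaving" by (rule L2_mixing[OF am f v orth'])
  moreover have "eventually (\<lambda>k. (\<integral>x. v (\<phi> k x) * v x \<partial>M) = (\<integral>x. f (\<phi> k x) * v x \<partial>M)) leaving"
  proof -
    have "(\<integral>x. v (\<phi> k x) * v x \<partial>M) = (\<integral>x. f (\<phi> k x) * v x \<partial>M)" if k: "k \<in> carrier G" for k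
    proof -
      have "(\<integral>x. P (\<phi> k x) * v x \<partial>M) = 0"
        using measurable_compose[OF measurable_act_pinsker[OF am k] P_meas(1)] L2_act[OF P_L2 k] by (rule orth)
      moreover have "(\<integral>x. v (\<phi> k x) * v x \<partial>M) = (\<integral>x. f (\<phi> k x) * v x \<partial>M) - (\<integral>x. P (\<phi> k x) * v x \<partial>M)"
        using integrable_mult_L2[OF L2_act[OF f k] v] integrable_mult_L2[OF L2_act[OF P_L2 k] v]
        by (simp add: v_def left_diff_distrib)
      ultimately show ?thesis by simp
    qed
    then show ?thesis by (auto simp: eventually_leaving intro: rev_finite_subset[of "{}"])
  qed
  ultimately have "((\<lambda>k. \<integral>x. v (\<phi> k x) * v x \<partial>M) \<longlongrightarrow> 0) leaving"
    by (simp add: filterlim_cong[OF refl refl])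
  from averages_vanish_if_mixing[OF v this S card]
  have "(\<lambda>n. L2_norm M (ergodic_average \<phi> (S n) v)) \<longlonglongrightarrow> 0" .
  moreover have "ergodic_average \<phi> T v = (\<lambda>x. ergodic_average \<phi> T f x - ergodic_average \<phi> T P x)" for T
    by (simp add: fun_eq_iff v_def ergodic_average_def sum_subtractf diff_divide_distrib)
  ultimately show "(\<lambda>n. L2_norm M (\<lambda>x. ergodic_average \<phi> (S n) f x
     - ergodic_average \<phi> (S n) (real_cond_exp M pinsker f) x)) \<longlonglongrightarrow> 0"
    by (simp add: P_def)
qed

end

section \<open>The completed system\<close>

text \<open>Continuity makes the action Borel measurable; it preserves null sets, so it stays measurable and
  measure preserving on the completed \<open>\<sigma>\<close>-algebra.\<close>

lemma (in G_mps) mp_action_completion: "mp_action (completion \<mu>) G \<phi>"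
proof -
  interpret C: prob_space "completion \<mu>" by (rule prob_space_completion)
  interpret group G using group_hom group_hom.axioms(1) by blast
  have sp: "space \<mu> = UNIV" using sets_eq_imp_space_eq[OF sets_borel] by simp
  have meas: "\<phi> g \<in> measurable \<mu> \<mu>" if "g \<in> carrier G" for g
    using borel_measurable_continuous_onI[OF continuous_action[OF that]] sets_borel
    by (simp cong: measurable_cong_sets)
  have dis: "distr \<mu> \<mu> (\<phi> g) = \<mu>" if g: "g \<in> carrier G" for g
  proof (rule measure_eqI)
    fix A assume "A \<in> sets (distr \<mu> \<mu> (\<phi> g))"
    then show "emeasure (distr \<mu> \<mu> (\<phi> g)) A = emeasure \<mu> A"
      using meas[OF g] invariant[OF g, of A] by (simp add: emeasure_distr sp emeasure_eq_measure sets_borel)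
  qed simp
  have cdis: "distr (completion \<mu>) \<mu> (\<phi> g) = \<mu>" if g: "g \<in> carrier G" for g
    using distr_completion[OF meas[OF g]] dis[OF g] by simp
  show ?thesis
  proof
    show "space (completion \<mu>) = UNIV" by (simp add: sp)
    fix g assume g: "g \<in> carrier G"
    show m: "\<phi> g \<in> measurable (completion \<mu>) (completion \<mu>)"
      using measurable_completion[OF meas[OF g]] cdis[OF g] by (intro completion.measurable_completion2) auto
    fix A assume A: "A \<in> sets (completion \<mu>)"
    have "completion \<mu> = distr (completion \<mu>) (completion \<mu>) (\<phi> g)"
      using completion.completion_distr_eq[OF measurable_completion[OF meas[OF g]]] cdis[OF g] by simp
    then have "measure (completion \<mu>) A = measure (distr (completion \<mu>) (completion \<mu>) (\<phi> g)) A" by simp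
    also have "\<dots> = measure (completion \<mu>) (\<phi> g -` A)"
      using m A by (simp add: measure_distr sp)
    finally show "measure (completion \<mu>) (\<phi> g -` A) = measure (completion \<mu>) A" by simp
  next
    fix g h x assume "g \<in> carrier G" "h \<in> carrier G"
    then show "\<phi> (g \<otimes> h) x = \<phi> g (\<phi> h x)" by (intro composition_rule) auto
  next
    fix x show "\<phi> \<one> x = x" using id_eq_one by (metis UNIV_I restrict_apply)
  qed
qed

theorem theorem1p3:
  fixes G :: "('g, 'b) monoid_scheme"
    and \<phi> :: "'g \<Rightarrow> 'x :: metric_space \<Rightarrow> 'x"
    and \<mu> :: "'x measure"
    and S :: "nat \<Rightarrow> 'g set"
  assumes "infinite (carrier G)" and "countable (carrier G)" and "amenable G"
    and "ergodic_G_mps G \<phi> \<mu>"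
    and "\<And>n. n \<ge> 1 \<Longrightarrow> S n \<subseteq> carrier G \<and> finite (S n) \<and> S n \<noteq> {}"
    and "filterlim (\<lambda>n. card (S n)) at_top sequentially"
  shows "characteristic_factor (completion \<mu>) \<phi> S (pinsker_algebra G \<phi> (completion \<mu>))"
proof -
  interpret ergodic_G_mps G \<phi> \<mu> by (rule assms(4))
  show ?thesis
    by (rule mp_action.pinsker_algebra_characteristic[OF mp_action_completion assms(3,5,6)])
qed

end
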